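(* Consider the Erdős-Rényi random graph on $[n]$ with edge probability $p=p_n$ (self-loops allowed), where $(\log n)^{4\xi}/n\ll p\ll n^{-1/2}$ for some $\xi>2$. Let $v_1$ be the eigenvector corresponding to the largest eigenvalue of its adjacency matrix, normalized so that $\|v_1\|_2=1$ and with sign chosen so that $\sum_{j}v_1(j)\ge0$. Then, for all $i\in[n]$, $$n\sqrt{\frac{p}{1-p}}\left(v_1(i)-\frac{1}{\sqrt n}\right)\longrightarrow\mathcal{N}(0,1)\quad\text{in distribution as } n\to\infty.$$
   Context: The Erdős-Rényi random graph with self-loops on $[n]=\{1,\dots,n\}$: for each unordered pair of vertices $i,j$ (not necessarily distinct) an edge is present independently with probability $p$. Its adjacency matrix is the symmetric $n\times n$ matrix whose entries with $i\le j$ are independent Bernoulli($p$) random variables. $v_1(i)$ denotes the $i$-th coordinate of $v_1$. $a_n\ll b_n$ means $a_n/b_n\to0$ as $n\to\infty$. $\mathcal{N}(0,1)$ is the standard Gaussian law. Whenever the eigenvector is not uniquely determined (an event of negligible probability), any measurable choice is made. *)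

theory Defs
  imports
    "HOL-Probability.Probability"
    "HOL-Library.Landau_Symbols"
    "Jordan_Normal_Form.Char_Poly"
begin

text \<open>
  The vertex set is \<open>{..<n}\<close>, to agree with the indexing of the matrix library.
  A graph on it is a set of unordered pairs; the singletons \<open>{i, i} = {i}\<close> are the self-loops.
\<close>

definition vertex_pairs :: "nat \<Rightarrow> nat set set" where
  "vertex_pairs n = {{i, j} | i j. i < n \<and> j < n}"

definition adjacency_matrix :: "nat \<Rightarrow> nat set set \<Rightarrow> real mat" where
  "adjacency_matrix n G = mat n n (\<lambda>(i, j). if {i, j} \<in> G then 1 else 0)"

locale erdos_renyi_graph = prob_space M
  for M :: "'w measure" and n :: nat and p :: real and G :: "'w \<Rightarrow> nat set set" +
  assumes edges_subset: "\<And>\<omega>. \<omega> \<in> space M \<Longrightarrow> G \<omega> \<subseteq> vertex_pairs n"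
    and indep_edges: "indep_events (\<lambda>e. {\<omega> \<in> space M. e \<in> G \<omega>}) (vertex_pairs n)"
    and prob_edge: "\<And>e. e \<in> vertex_pairs n \<Longrightarrow> prob {\<omega> \<in> space M. e \<in> G \<omega>} = p"

definition largest_eigenvalue :: "real mat \<Rightarrow> real \<Rightarrow> bool" where
  "largest_eigenvalue A k \<longleftrightarrow> eigenvalue A k \<and> (\<forall>k'. eigenvalue A k' \<longrightarrow> k' \<le> k)"

text \<open>
  If the largest eigenvalue is not simple, or if the entries sum to zero, then several vectors
  satisfy the following predicate.
\<close>

definition normalized_top_eigenvector :: "real mat \<Rightarrow> real Matrix.vec \<Rightarrow> bool" where
  "normalized_top_eigenvector A v \<longleftrightarrow>
     (\<exists>k. largest_eigenvalue A k \<and> eigenvector A v k) \<and>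
     sqrt (\<Sum>j<dim_vec v. (vec_index v j)\<^sup>2) = 1 \<and>
     (\<Sum>j<dim_vec v. vec_index v j) \<ge> 0"

end

theory Submission
  imports
    Defs
    "HOL-Combinatorics.Transposition"
    "HOL-Real_Asymp.Real_Asymp"
begin

text \<open>
  Write the adjacency matrix as \<open>d e e\<^sup>T + W\<close> with \<open>d = n p\<close>, \<open>e = (1, \<dots>, 1) / \<surd>n\<close> and \<open>W\<close> centred.
  If \<open>\<parallel>W\<parallel>\<close> is small compared to \<open>d\<close>, the top eigenvector is unique and equals \<open>e + W e / d + r\<close> with
  \<open>\<parallel>r\<parallel>\<^sup>2 \<ll> 1 / d\<close>. The bound on \<open>\<parallel>W\<parallel>\<close> comes from the trace of \<open>W\<close> to a power of order \<open>ln n\<close>; a crude count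
  of walks is enough since \<open>d \<ge> (ln n)\<^sup>8\<close>. Uniqueness makes the eigenvector equivariant under
  relabelling of the vertices, so every coordinate of \<open>r\<close> has second moment \<open>\<parallel>r\<parallel>\<^sup>2 / n\<close>, which is
  negligible at the scale of the statement. What remains is the row sum of \<open>W\<close> at the vertex \<open>i\<close>, a sum of \<open>n\<close>
  independent centred Bernoulli variables, whose characteristic function is computed directly.
\<close>

section \<open>Perturbation of a rank-one matrix\<close>

text \<open>A single slack parameter \<open>K\<close>, finally \<open>ln n\<close>, governs all
  estimates. With \<open>\<parallel>W\<parallel> \<le> d / K\<close>,
  \<open>\<parallel>W e\<parallel>\<^sup>2 \<le> K d\<close> and
  \<open>(e . W e)\<^sup>2 \<le> K\<close>, the remainder satisfies \<open>sqrt d *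
  \<parallel>r\<parallel> = O(K / sqrt d + 1 / sqrt K)\<close>, so \<open>K\<close> has to grow, but
  slower than \<open>sqrt d\<close>. The trace bound asks for more: \<open>K ln n\<close> has to be
  small against \<open>sqrt d\<close>, which \<open>d \<ge> (ln n)\<^sup>8\<close> allows. The
  obstacle is that the eigenvector is an arbitrary measurable choice on the sample space. It is not
  a function of the graph, so it can be neither relabelled nor averaged over graphs. Where the three
  bounds hold, uniqueness identifies it with a fixed selection that depends on the graph alone, and
  expectations become finite sums over graphs. The remaining graphs have vanishing probability and
  move a characteristic function by at most twice that probability, so nothing has to be known about
  the eigenvector there.\<close>

definition dot :: "nat \<Rightarrow> (nat \<Rightarrow> real) \<Rightarrow> (nat \<Rightarrow> real) \<Rightarrow> real" where
  "dot n x y = (\<Sum>i<n. x i * y i)"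

definition nrm :: "nat \<Rightarrow> (nat \<Rightarrow> real) \<Rightarrow> real" where
  "nrm n x = L2_set x {..<n}"

definition mat_app :: "nat \<Rightarrow> (nat \<Rightarrow> nat \<Rightarrow> real) \<Rightarrow> (nat \<Rightarrow> real) \<Rightarrow> nat \<Rightarrow> real" where
  "mat_app n a x i = (\<Sum>j<n. a i j * x j)"

lemma dot_commute: "dot n x y = dot n y x"
  by (simp add: dot_def mult.commute)

lemma dot_cong: "(\<And>i. i < n \<Longrightarrow> x i = x' i) \<Longrightarrow> (\<And>i. i < n \<Longrightarrow> y i = y' i) \<Longrightarrow> dot n x y = dot n x' y'"
  by (simp add: dot_def)

lemma nrm_cong: "(\<And>i. i < n \<Longrightarrow> x i = y i) \<Longrightarrow> nrm n x = nrm n y"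
  unfolding nrm_def by (intro L2_set_cong) auto

lemma mat_app_cong: "(\<And>j. j < n \<Longrightarrow> x j = y j) \<Longrightarrow> mat_app n a x = mat_app n a y"
  by (auto simp: mat_app_def)

lemma dot_linear [simp]:
  "dot n x (\<lambda>i. y i + z i) = dot n x y + dot n x z"
  "dot n x (\<lambda>i. y i - z i) = dot n x y - dot n x z"
  "dot n x (\<lambda>i. c * y i) = c * dot n x y"
  "dot n (\<lambda>i. y i + z i) x = dot n y x + dot n z x"
  "dot n (\<lambda>i. y i - z i) x = dot n y x - dot n z x"
  "dot n (\<lambda>i. c * y i) x = c * dot n y x"
  by (auto simp: dot_def algebra_simps sum.distrib sum_subtractf sum_distrib_left)

lemma mat_app_linear [simp]:
  "mat_app n a (\<lambda>j. x j + y j) i = mat_app n a x i + mat_app n a y i"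
  "mat_app n a (\<lambda>j. x j - y j) i = mat_app n a x i - mat_app n a y i"
  "mat_app n a (\<lambda>j. c * x j) i = c * mat_app n a x i"
  by (auto simp: mat_app_def algebra_simps sum.distrib sum_subtractf sum_distrib_left)

lemma dot_mat_app_sym:
  assumes "\<And>i j. a i j = a j i"
  shows "dot n x (mat_app n a y) = dot n (mat_app n a x) y"
proof -
  have "dot n x (mat_app n a y) = (\<Sum>i<n. \<Sum>j<n. x i * (a i j * y j))"
    by (simp add: dot_def mat_app_def sum_distrib_left)
  also have "\<dots> = (\<Sum>j<n. \<Sum>i<n. x i * (a i j * y j))"
    by (rule sum.swap)
  also have "\<dots> = (\<Sum>j<n. \<Sum>i<n. (a j i * x i) * y j)"
  proof (intro sum.cong refl)
    fix i j show "x i * (a i j * y j) = (a j i * x i) * y j" using assms[of i j] by simp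
  qed
  also have "\<dots> = dot n (mat_app n a x) y"
    by (simp add: dot_def mat_app_def sum_distrib_right)
  finally show ?thesis .
qed

lemma nrm_nonneg [simp]: "0 \<le> nrm n x"
  by (simp add: nrm_def)

lemma nrm_power2: "(nrm n x)\<^sup>2 = dot n x x"
  by (simp add: nrm_def L2_set_def dot_def sum_nonneg power2_eq_square)

lemma dot_self_nonneg: "0 \<le> dot n x x"
  by (simp flip: nrm_power2)

lemma nrm_eq_sqrt: "nrm n x = sqrt (dot n x x)"
  by (simp flip: nrm_power2)

lemma abs_dot_le: "\<bar>dot n x y\<bar> \<le> nrm n x * nrm n y"
proof -
  have "\<bar>dot n x y\<bar> \<le> (\<Sum>i<n. \<bar>x i\<bar> * \<bar>y i\<bar>)"
    unfolding dot_def by (rule order_trans[OF sum_abs]) (simp add: abs_mult)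
  also have "\<dots> \<le> nrm n x * nrm n y"
    unfolding nrm_def by (rule L2_set_mult_ineq)
  finally show ?thesis .
qed

lemma dot_le: "dot n x y \<le> nrm n x * nrm n y"
  using abs_dot_le[of n x y] by linarith

lemma nrm_triangle: "nrm n (\<lambda>i. x i + y i) \<le> nrm n x + nrm n y"
  unfolding nrm_def by (rule L2_set_triangle_ineq)

lemma nrm_scale: "nrm n (\<lambda>i. c * x i) = \<bar>c\<bar> * nrm n x"
  unfolding nrm_eq_sqrt by (simp add: real_sqrt_mult mult.assoc[symmetric])

lemma nrm_le_add_diff: "nrm n x \<le> nrm n (\<lambda>i. x i - y i) + nrm n y"
  using nrm_triangle[of n "\<lambda>i. x i - y i" y] by simp

lemma sum_power2_eq_dot: "(\<Sum>i<n. (x i)\<^sup>2) = dot n x x"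
  by (simp add: dot_def power2_eq_square)

text \<open>
  For a matrix \<open>d e e\<^sup>T + w\<close> with \<open>\<parallel>w\<parallel> \<le> s\<close> small compared to \<open>d\<close>: splitting \<open>v = c e + u\<close> with
  \<open>u\<close> orthogonal to \<open>e\<close>, the eigenvector equation paired with \<open>u\<close> gives \<open>\<parallel>u\<parallel> = O(\<parallel>w e\<parallel> / d)\<close>.
  Then \<open>(l - w)\<close>, which is bounded below by \<open>3d/4\<close>, is applied to the remainder.
\<close>

lemma top_eigenvector_expansion:
  fixes n :: nat and w :: "nat \<Rightarrow> nat \<Rightarrow> real" and e v :: "nat \<Rightarrow> real" and d l s :: real
  defines "f \<equiv> mat_app n w e"
  assumes sym: "\<And>i j. w i j = w j i"
    and op: "\<And>x. nrm n (mat_app n w x) \<le> s * nrm n x"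
    and e: "dot n e e = 1" and v: "dot n v v = 1"
    and pos: "dot n e v \<ge> 0"
    and eig: "\<And>i. i < n \<Longrightarrow> mat_app n w v i + d * dot n e v * e i = l * v i"
    and ray: "d + dot n e f \<le> l"
    and d: "d > 0" and s: "s \<le> d / 8"
  shows "dot n e v > 0" and "s < l"
    and "d\<^sup>2 * nrm n (\<lambda>i. v i - e i - f i / d) \<le>
           7 * (nrm n f)\<^sup>2 + 3 * d * \<bar>dot n e f\<bar> + 2 * s * nrm n f"
proof -
  define c where "c = dot n e v"
  define b where "b = nrm n f"
  define q where "q = dot n e f"
  define u where "u = (\<lambda>i. v i - c * e i)"
  define m where "m = nrm n u"
  have ne: "nrm n e = 1" and nv: "nrm n v = 1" by (simp_all add: nrm_eq_sqrt e v)
  have b0: "0 \<le> b" and m0: "0 \<le> m" by (simp_all add: b_def m_def)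
  have bs: "b \<le> s" using op[of e] by (simp add: b_def f_def ne)
  have qb: "\<bar>q\<bar> \<le> b" using abs_dot_le[of n e f] by (simp add: q_def b_def ne)
  have s0: "0 \<le> s" using b0 bs by linarith
  \<comment> \<open>The Rayleigh bound gives \<open>l \<ge> d - s\<close> because
    \<open>\<bar>q\<bar> \<le> b \<le> s\<close>, and \<open>s \<le> d / 8\<close> leaves
    \<open>d - 2 * s \<ge> 3/4 * d\<close>.\<close>
  have ls: "l - s \<ge> 3/4 * d" using ray qb bs s by (simp add: q_def)
  then show sl: "s < l" using d by linarith
  have c1: "c \<le> 1" using dot_le[of n e v] by (simp add: c_def ne nv)
  have c0: "c \<ge> 0" using pos by (simp add: c_def)
  have eu: "dot n e u = 0" "dot n u e = 0"
    by (simp_all add: u_def e c_def dot_commute[of n v e])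
  have ve: "dot n v e = c" by (simp add: c_def dot_commute)
  have uv: "dot n u v = m\<^sup>2" "m\<^sup>2 = 1 - c\<^sup>2"
    unfolding m_def nrm_power2
    by (simp_all add: u_def v e c_def[symmetric] ve power2_eq_square)
  have appv: "mat_app n w v i = mat_app n w u i + c * f i" for i
    by (simp add: u_def f_def)
  have "l * m\<^sup>2 = dot n u (\<lambda>i. l * v i)" by (simp add: uv)
  also have "\<dots> = dot n u (\<lambda>i. mat_app n w v i + (d * c) * e i)"
    by (intro dot_cong) (simp_all add: eig c_def)
  also have "\<dots> = dot n u (mat_app n w v)" by (simp add: eu)
  also have "\<dots> = dot n u (\<lambda>i. mat_app n w u i + c * f i)"
    by (intro dot_cong) (simp_all add: appv)
  also have "\<dots> = dot n u (mat_app n w u) + c * dot n u f" by simp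
  also have "\<dots> \<le> s * m\<^sup>2 + m * b"
  proof (rule add_mono)
    have "dot n u (mat_app n w u) \<le> m * nrm n (mat_app n w u)"
      unfolding m_def by (rule dot_le)
    also have "\<dots> \<le> m * (s * m)" using op[of u] m0 by (intro mult_left_mono) (auto simp: m_def)
    finally show "dot n u (mat_app n w u) \<le> s * m\<^sup>2" by (simp add: power2_eq_square mult_ac)
    have "c * dot n u f \<le> \<bar>c\<bar> * \<bar>dot n u f\<bar>" by (metis abs_ge_self abs_mult)
    also have "\<dots> \<le> 1 * (m * b)"
      using c0 c1 abs_dot_le[of n u f] by (intro mult_mono) (auto simp: m_def b_def)
    finally show "c * dot n u f \<le> m * b" by simp
  qed
  finally have "m * ((l - s) * m) \<le> m * b" by (simp add: power2_eq_square algebra_simps)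
  then have "(l - s) * m \<le> b" if "m > 0" using that by simp
  then have "(l - s) * m \<le> b" using b0 m0 by (cases "m = 0") auto
  then have dm: "3/4 * d * m \<le> b" using mult_right_mono[OF ls m0] by linarith
  then have "d * m \<le> d * (1/6)" using bs s by linarith
  then have m6: "m \<le> 1/6" using d by (simp add: mult_le_cancel_left_pos)
  have "m\<^sup>2 \<le> (1/6)\<^sup>2" by (intro power_mono m6 m0)
  \<comment> \<open>The sign convention enters here: for \<open>0 \<le> c \<le> 1\<close> the square
    lies below \<open>c\<close>, so \<open>c\<^sup>2 = 1 - m\<^sup>2\<close> bounds the overlap
    itself from below.\<close>
  moreover have c2: "c\<^sup>2 \<le> c" using c0 c1 by (simp add: power2_eq_square mult_left_le)
  ultimately have chalf: "c \<ge> 1/2" using uv by (simp add: power2_eq_square)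
  then show "dot n e v > 0" by (simp add: c_def)
  have onec: "1 - c \<le> m\<^sup>2" using uv c2 by linarith
  \<comment> \<open>Pairing the eigenvector equation with \<open>e\<close> instead of
    \<open>u\<close> locates the eigenvalue within \<open>2 * (b * m + \<bar>q\<bar>)\<close> of
    \<open>d\<close>.\<close>
  have "l * c = dot n e (\<lambda>i. l * v i)" by (simp add: c_def)
  also have "\<dots> = dot n e (\<lambda>i. mat_app n w v i + (d * c) * e i)"
    by (intro dot_cong) (simp_all add: eig c_def)
  also have "\<dots> = dot n e (mat_app n w v) + d * c" by (simp add: e)
  also have "dot n e (mat_app n w v) = dot n f v"
    unfolding f_def by (rule dot_mat_app_sym) (rule sym)
  also have "dot n f v = dot n f (\<lambda>i. u i + c * e i)" by (intro dot_cong) (simp_all add: u_def)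
  also have "\<dots> = dot n f u + c * q" by (simp add: q_def dot_commute)
  finally have "(l - d) * c = dot n f u + c * q" by (simp add: algebra_simps)
  moreover have "\<bar>dot n f u + c * q\<bar> \<le> b * m + \<bar>q\<bar>"
  proof -
    have "\<bar>c * q\<bar> \<le> 1 * \<bar>q\<bar>" unfolding abs_mult using c0 c1 by (intro mult_right_mono) auto
    then show ?thesis using abs_dot_le[of n f u] by (simp add: b_def m_def)
  qed
  ultimately have "\<bar>l - d\<bar> * c \<le> b * m + \<bar>q\<bar>" using c0 by (simp flip: abs_mult_pos)
  moreover have "\<bar>l - d\<bar> * (1/2) \<le> \<bar>l - d\<bar> * c" using chalf by (intro mult_left_mono) auto
  ultimately have "\<bar>l - d\<bar> * (1/2) \<le> b * m + \<bar>q\<bar>" by (meson order_trans)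
  then have ld: "\<bar>l - d\<bar> \<le> 2 * (b * m) + 2 * \<bar>q\<bar>" by simp
  define r where "r = (\<lambda>i. v i - e i - f i / d)"
  define R where "R = nrm n r"
  have R0: "0 \<le> R" by (simp add: R_def)
  \<comment> \<open>This is \<open>(l - w) r\<close>. Since \<open>(l - w) v\<close> is a multiple
    of \<open>e\<close> and \<open>(l - w) e = l e - f\<close>, the terms of first order in
    \<open>f\<close> cancel up to the factor \<open>1 - l / d\<close>.\<close>
  define g where "g = (\<lambda>i. l * r i - mat_app n w r i)"
  have r': "r = (\<lambda>i. v i - e i - (1/d) * f i)" by (simp add: r_def)
  have "g i = (d * c - l) * e i + ((1 - l / d) * f i + (1/d) * mat_app n w f i)" if "i < n" for i
  proof -
    have v: "mat_app n w v i = l * v i - d * c * e i" using eig[OF that] by (simp add: c_def)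
    show ?thesis unfolding g_def r' mat_app_linear f_def[symmetric] v
      using d by (simp add: field_simps)
  qed
  then have "nrm n g = nrm n (\<lambda>i. (d * c - l) * e i + ((1 - l / d) * f i + (1/d) * mat_app n w f i))"
    by (rule nrm_cong)
  also have "\<dots> \<le> \<bar>d * c - l\<bar> * 1 + (\<bar>1 - l / d\<bar> * b + \<bar>1/d\<bar> * nrm n (mat_app n w f))"
    by (rule order_trans[OF nrm_triangle add_mono[OF _ order_trans[OF nrm_triangle]]])
       (simp_all only: nrm_scale ne b_def order_refl)
  also have "\<dots> \<le> \<bar>d * c - l\<bar> * 1 + (\<bar>1 - l / d\<bar> * b + \<bar>1/d\<bar> * (s * b))"
    using op[of f] by (intro add_left_mono mult_left_mono) (auto simp: b_def)
  finally have gup: "nrm n g \<le> \<bar>d * c - l\<bar> + (\<bar>1 - l / d\<bar> * b + \<bar>1/d\<bar> * (s * b))" by simp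
  have l0: "l \<ge> 0" using sl s0 by linarith
  have "l * R \<le> nrm n g + nrm n (mat_app n w r)"
    using nrm_le_add_diff[of n "\<lambda>i. l * r i" "mat_app n w r"] l0
    by (simp add: nrm_scale R_def g_def)
  then have "(l - s) * R \<le> nrm n g" using op[of r] by (simp add: R_def algebra_simps)
  then have "3/4 * d * R \<le> nrm n g" using mult_right_mono[OF ls R0] by linarith
  then have "d * (3/4 * d * R) \<le> d * (\<bar>d * c - l\<bar> + (\<bar>1 - l / d\<bar> * b + \<bar>1/d\<bar> * (s * b)))"
    using d by (intro mult_left_mono order_trans[OF _ gup]) auto
  also have "\<dots> = d * \<bar>d * c - l\<bar> + (d * \<bar>1 - l / d\<bar> * b + s * b)"
    using d by (simp add: distrib_left)
  also have "d * \<bar>1 - l / d\<bar> = \<bar>d * (1 - l / d)\<bar>" using d by (simp add: abs_mult)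
  also have "d * (1 - l / d) = d - l" using d by (simp add: field_simps)
  also have "\<bar>d * c - l\<bar> \<le> d * m\<^sup>2 + \<bar>l - d\<bar>"
  proof -
    have "\<bar>d * c - l\<bar> \<le> \<bar>d * c - d\<bar> + \<bar>l - d\<bar>" by linarith
    also have "\<bar>d * c - d\<bar> = d * (1 - c)" using d c1 by (simp add: abs_if algebra_simps)
    also have "\<dots> \<le> d * m\<^sup>2" using onec d by (intro mult_left_mono) auto
    finally show ?thesis by simp
  qed
  finally have main: "d * (3/4 * d * R) \<le> d * (d * m\<^sup>2 + \<bar>l - d\<bar>) + (\<bar>l - d\<bar> * b + s * b)"
    using d by (simp add: abs_minus_commute)
  have b8: "b \<le> d / 8" using bs s by linarith
  have "\<bar>l - d\<bar> * b \<le> \<bar>l - d\<bar> * (d / 8)" using b8 by (intro mult_left_mono) auto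
  then have "3/4 * (d\<^sup>2 * R) \<le> (d * m)\<^sup>2 + 9/8 * (d * \<bar>l - d\<bar>) + s * b"
    using main by (simp add: power2_eq_square algebra_simps)
  moreover have "(d * m)\<^sup>2 \<le> 16/9 * b\<^sup>2"
    using dm d m0 power_mono[of "d * m" "4/3 * b" 2] by (simp add: power_mult_distrib power2_eq_square)
  moreover have "d * \<bar>l - d\<bar> \<le> 2 * (b * (d * m)) + 2 * (d * \<bar>q\<bar>)"
    using mult_left_mono[OF ld, of d] d by (simp add: algebra_simps)
  moreover have "b * (d * m) \<le> 4/3 * b\<^sup>2"
    using dm b0 mult_left_mono[of "d * m" "4/3 * b" b] by (simp add: power2_eq_square)
  moreover have "0 \<le> s * b" "0 \<le> d * \<bar>q\<bar>" "0 \<le> b\<^sup>2" using s0 b0 d by simp_all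
  \<comment> \<open>After multiplication by 4/3 the coefficients of \<open>b\<^sup>2\<close>,
    \<open>d * \<bar>q\<bar>\<close> and \<open>s * b\<close> are 172/27, 3 and 4/3; they are
    rounded up to 7, 3 and 2.\<close>
  ultimately have "d\<^sup>2 * R \<le> 7 * b\<^sup>2 + 3 * (d * \<bar>q\<bar>) + 2 * (s * b)" by linarith
  then show "d\<^sup>2 * nrm n (\<lambda>i. v i - e i - f i / d) \<le>
           7 * (nrm n f)\<^sup>2 + 3 * d * \<bar>dot n e f\<bar> + 2 * s * nrm n f"
    by (simp add: R_def r_def b_def q_def mult.assoc)
qed

section \<open>Matrix powers and walks\<close>

primrec mpow :: "nat \<Rightarrow> (nat \<Rightarrow> nat \<Rightarrow> real) \<Rightarrow> nat \<Rightarrow> nat \<Rightarrow> nat \<Rightarrow> real" where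
  "mpow n a 0 i j = (if i = j then 1 else 0)"
| "mpow n a (Suc k) i j = (\<Sum>l<n. a i l * mpow n a k l j)"

lemma mat_app_mpow: "i < n \<Longrightarrow> mat_app n (mpow n a k) x i = ((mat_app n a) ^^ k) x i"
proof (induction k arbitrary: i)
  case 0
  have "(\<Sum>j<n. (if i = j then 1 else 0) * x j) = (\<Sum>j<n. if j = i then x j else 0)"
    by (intro sum.cong) auto
  with 0 show ?case by (simp add: mat_app_def)
next
  case (Suc k)
  have "mat_app n (mpow n a (Suc k)) x i = (\<Sum>j<n. \<Sum>l<n. a i l * (mpow n a k l j * x j))"
    by (simp add: mat_app_def sum_distrib_right mult.assoc)
  also have "\<dots> = (\<Sum>l<n. \<Sum>j<n. a i l * (mpow n a k l j * x j))"
    by (rule sum.swap)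
  also have "\<dots> = mat_app n a (mat_app n (mpow n a k) x) i"
    by (simp add: mat_app_def sum_distrib_left)
  also have "mat_app n a (mat_app n (mpow n a k) x) = mat_app n a (((mat_app n a) ^^ k) x)"
    by (intro mat_app_cong Suc.IH)
  finally show ?case by simp
qed

lemma nrm_mat_app_le_frobenius:
  "(nrm n (mat_app n a x))\<^sup>2 \<le> (\<Sum>i<n. \<Sum>j<n. (a i j)\<^sup>2) * (nrm n x)\<^sup>2"
proof -
  have "(mat_app n a x i)\<^sup>2 \<le> (\<Sum>j<n. (a i j)\<^sup>2) * (nrm n x)\<^sup>2" for i
  proof -
    have "(mat_app n a x i)\<^sup>2 = \<bar>dot n (a i) x\<bar>\<^sup>2" by (simp add: mat_app_def dot_def)
    also have "\<dots> \<le> (nrm n (a i) * nrm n x)\<^sup>2" by (intro power_mono abs_dot_le) auto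
    finally show ?thesis by (simp add: power_mult_distrib nrm_power2 sum_power2_eq_dot)
  qed
  then have "(\<Sum>i<n. (mat_app n a x i)\<^sup>2) \<le> (\<Sum>i<n. (\<Sum>j<n. (a i j)\<^sup>2) * (nrm n x)\<^sup>2)"
    by (rule sum_mono)
  then show ?thesis by (simp add: sum_power2_eq_dot nrm_power2 sum_distrib_right)
qed

text \<open>
  The ratios \<open>\<parallel>A\<^bsup>m+1\<^esup> x\<parallel> / \<parallel>A\<^bsup>m\<^esup> x\<parallel>\<close> increase with \<open>m\<close>, so the Frobenius norm of a high power
  controls the operator norm without the spectral theorem.
\<close>

lemma log_convex_power_le:
  fixes y :: "nat \<Rightarrow> real"
  assumes nonneg: "\<And>k. 0 \<le> y k" and conv: "\<And>k. (y (Suc k))\<^sup>2 \<le> y k * y (Suc (Suc k))"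
  shows "y 1 ^ Suc k \<le> y (Suc k) * y 0 ^ k"
proof -
  have ratio: "y 1 * y k \<le> y (Suc k) * y 0" for k
  proof (induction k)
    case (Suc k)
    show ?case
    proof (cases "y (Suc k) = 0")
      case False
      \<comment> \<open>If \<open>y k\<close> vanished, the convexity assumption would force
        \<open>y (Suc k)\<close> to vanish as well.\<close>
      then have "y k \<noteq> 0" using conv[of k] by auto
      then have yk: "y k > 0" using nonneg[of k] by simp
      have "y k * (y 1 * y (Suc k)) = (y 1 * y k) * y (Suc k)" by simp
      also have "\<dots> \<le> (y (Suc k) * y 0) * y (Suc k)" using Suc nonneg by (intro mult_right_mono)
      also have "\<dots> = (y (Suc k))\<^sup>2 * y 0" by (simp add: power2_eq_square)
      also have "\<dots> \<le> (y k * y (Suc (Suc k))) * y 0" using conv nonneg by (intro mult_right_mono)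
      finally have "y k * (y 1 * y (Suc k)) \<le> y k * (y (Suc (Suc k)) * y 0)" by (simp add: mult.assoc)
      with yk show ?thesis by simp
    qed (simp add: nonneg)
  qed simp
  show ?thesis
  proof (induction k)
    case (Suc k)
    have "y 1 ^ Suc (Suc k) = y 1 * y 1 ^ Suc k" by simp
    also have "\<dots> \<le> y 1 * (y (Suc k) * y 0 ^ k)" by (rule mult_left_mono[OF Suc.IH nonneg])
    also have "\<dots> = (y 1 * y (Suc k)) * y 0 ^ k" by simp
    also have "\<dots> \<le> (y (Suc (Suc k)) * y 0) * y 0 ^ k"
      by (intro mult_right_mono ratio) (simp add: nonneg)
    finally show ?case by (simp add: mult.assoc)
  qed simp
qed

text \<open>Symmetry and Cauchy-Schwarz make the norms of the iterates log-convex. Replacing the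
  operator norm of the power by its Frobenius norm loses at most a factor \<open>sqrt n\<close>
  before the root of order \<open>k + 1\<close> is taken, hence a bounded factor once
  \<open>k\<close> is of order \<open>ln n\<close>.\<close>

lemma nrm_mat_app_le_of_mpow:
  assumes sym: "\<And>i j. a i j = a j i" and s: "0 \<le> s"
    and frob: "(\<Sum>i<n. \<Sum>j<n. (mpow n a (Suc k) i j)\<^sup>2) \<le> s ^ (2 * Suc k)"
  shows "nrm n (mat_app n a x) \<le> s * nrm n x"
proof -
  define y where "y = (\<lambda>m. nrm n (((mat_app n a) ^^ m) x))"
  have conv: "(y (Suc m))\<^sup>2 \<le> y m * y (Suc (Suc m))" for m
  proof -
    let ?z = "((mat_app n a) ^^ m) x"
    have "(y (Suc m))\<^sup>2 = dot n (mat_app n a ?z) (mat_app n a ?z)" by (simp add: y_def nrm_power2)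
    also have "\<dots> = dot n ?z (mat_app n a (mat_app n a ?z))"
      by (rule dot_mat_app_sym[symmetric]) (rule sym)
    also have "\<dots> \<le> y m * y (Suc (Suc m))" unfolding y_def by (rule order_trans[OF dot_le]) simp
    finally show ?thesis .
  qed
  have "(y (Suc k))\<^sup>2 = (nrm n (mat_app n (mpow n a (Suc k)) x))\<^sup>2"
    unfolding y_def by (subst nrm_cong[OF mat_app_mpow]) simp_all
  also have "\<dots> \<le> (\<Sum>i<n. \<Sum>j<n. (mpow n a (Suc k) i j)\<^sup>2) * (nrm n x)\<^sup>2"
    by (rule nrm_mat_app_le_frobenius)
  also have "\<dots> \<le> s ^ (2 * Suc k) * (nrm n x)\<^sup>2" by (rule mult_right_mono[OF frob]) simp
  also have "\<dots> = (s ^ Suc k * nrm n x)\<^sup>2"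
    unfolding power_mult_distrib power_mult[symmetric] by (simp only: mult.commute)
  finally have "y (Suc k) \<le> s ^ Suc k * nrm n x"
    by (rule power2_le_imp_le) (simp add: s)
  then have "y (Suc k) * y 0 ^ k \<le> (s ^ Suc k * nrm n x) * nrm n x ^ k"
    by (simp add: y_def mult_right_mono)
  with log_convex_power_le[of y k] conv
  have "y 1 ^ Suc k \<le> (s * nrm n x) ^ Suc k"
    unfolding power_mult_distrib by (simp add: y_def mult.assoc)
  then have "y 1 \<le> s * nrm n x" by (rule power_le_imp_le_base) (simp add: s)
  then show ?thesis by (simp add: y_def)
qed

section \<open>Traces of powers as sums over closed walks\<close>

lemma mpow_add:
  "i < n \<Longrightarrow> mpow n a (k + l) i j = (\<Sum>m<n. mpow n a k i m * mpow n a l m j)"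
proof (induction k arbitrary: i)
  case 0
  have "(\<Sum>m<n. mpow n a 0 i m * mpow n a l m j) = (\<Sum>m<n. if m = i then mpow n a l m j else 0)"
    by (intro sum.cong) auto
  with 0 show ?case by simp
next
  case (Suc k)
  have "mpow n a (Suc k + l) i j = (\<Sum>r<n. \<Sum>m<n. a i r * (mpow n a k r m * mpow n a l m j))"
    by (simp add: Suc.IH sum_distrib_left)
  also have "\<dots> = (\<Sum>m<n. \<Sum>r<n. a i r * (mpow n a k r m * mpow n a l m j))"
    by (rule sum.swap)
  also have "\<dots> = (\<Sum>m<n. mpow n a (Suc k) i m * mpow n a l m j)"
    by (simp add: sum_distrib_right mult.assoc)
  finally show ?case .
qed

lemma mpow_1: "j < n \<Longrightarrow> mpow n a (Suc 0) i j = a i j"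
proof -
  assume "j < n"
  moreover have "mpow n a (Suc 0) i j = (\<Sum>l<n. if l = j then a i l else 0)"
    unfolding mpow.simps by (intro sum.cong) auto
  ultimately show ?thesis by simp
qed

lemma mpow_sym:
  assumes sym: "\<And>i j. a i j = a j i"
  shows "i < n \<Longrightarrow> j < n \<Longrightarrow> mpow n a k i j = mpow n a k j i"
proof (induction k arbitrary: i j)
  case (Suc k)
  have "mpow n a (Suc k) i j = (\<Sum>m<n. mpow n a k i m * mpow n a (Suc 0) m j)"
    using mpow_add[OF Suc.prems(1), of a k "Suc 0" j] by simp
  also have "\<dots> = (\<Sum>m<n. a j m * mpow n a k m i)"
    using Suc by (intro sum.cong) (auto simp del: mpow.simps simp: mpow_1 sym[of _ j])
  finally show ?case by simp
qed auto

lemma frobenius_mpow_eq_trace: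
  assumes sym: "\<And>i j. a i j = a j i"
  shows "(\<Sum>i<n. \<Sum>j<n. (mpow n a k i j)\<^sup>2) = (\<Sum>i<n. mpow n a (2 * k) i i)"
proof (intro sum.cong refl)
  fix i assume "i \<in> {..<n}"
  then have i: "i < n" by simp
  have "(\<Sum>j<n. (mpow n a k i j)\<^sup>2) = (\<Sum>j<n. mpow n a k i j * mpow n a k j i)"
    by (intro sum.cong refl) (simp add: power2_eq_square mpow_sym[OF sym i])
  then show "(\<Sum>j<n. (mpow n a k i j)\<^sup>2) = mpow n a (2 * k) i i"
    using mpow_add[OF i, of a k k i] by (simp add: mult_2)
qed

text \<open>The length counts vertices, not steps: a walk with \<open>k\<close> steps is a list of
  length \<open>k + 1\<close>. In \<open>mpow_eq_sum_walks\<close> the starting vertex is prepended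
  separately, so there the lists have length \<open>k\<close>.\<close>

definition walks :: "nat \<Rightarrow> nat \<Rightarrow> nat list set" where
  "walks n k = {xs. set xs \<subseteq> {..<n} \<and> length xs = k}"

definition walk_prod :: "(nat \<Rightarrow> nat \<Rightarrow> real) \<Rightarrow> nat list \<Rightarrow> real" where
  "walk_prod a xs = (\<Prod>(i, j)\<leftarrow>zip xs (tl xs). a i j)"

lemma finite_walks [simp]: "finite (walks n k)"
  unfolding walks_def by (rule finite_lists_length_eq) simp

lemma sum_walks_Suc: "(\<Sum>xs\<in>walks n (Suc k). f xs) = (\<Sum>x<n. \<Sum>xs\<in>walks n k. f (x # xs))"
proof -
  have "walks n (Suc k) = (\<lambda>(x, xs). x # xs) ` ({..<n} \<times> walks n k)"
    by (auto simp: walks_def length_Suc_conv image_iff)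
  moreover have "inj_on (\<lambda>(x, xs). x # xs) ({..<n} \<times> walks n k)" by (auto intro: inj_onI)
  ultimately show ?thesis
    by (simp add: sum.reindex sum.cartesian_product case_prod_unfold)
qed

lemma mpow_eq_sum_walks:
  "mpow n a k i j = (\<Sum>xs\<in>walks n k. walk_prod a (i # xs) * of_bool (last (i # xs) = j))"
proof (induction k arbitrary: i)
  case 0
  have "walks n 0 = {[]}" by (auto simp: walks_def)
  then show ?case by (simp add: walk_prod_def)
next
  case (Suc k)
  show ?case
    unfolding sum_walks_Suc mpow.simps Suc.IH sum_distrib_left
    by (intro sum.cong refl) (simp add: walk_prod_def)
qed

lemma trace_mpow_eq_sum_walks:
  "(\<Sum>i<n. mpow n a k i i) =
     (\<Sum>xs\<in>walks n (Suc k). walk_prod a xs * of_bool (last xs = hd xs))"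
  unfolding sum_walks_Suc by (simp add: mpow_eq_sum_walks)

section \<open>The top eigenvector of a symmetric matrix\<close>

text \<open>Maximality of the eigenvalue is encoded by the Rayleigh quotient instead of a comparison
  with other eigenvalues. In this form it can be tested on the flat vector and transported along
  relabellings directly.\<close>

definition top_pair :: "nat \<Rightarrow> (nat \<Rightarrow> nat \<Rightarrow> real) \<Rightarrow> (nat \<Rightarrow> real) \<Rightarrow> real \<Rightarrow> bool" where
  "top_pair n a v l \<longleftrightarrow>
     (\<forall>i<n. mat_app n a v i = l * v i) \<and> (\<forall>x. dot n x (mat_app n a x) \<le> l * dot n x x) \<and>
     dot n v v = 1 \<and> 0 \<le> (\<Sum>i<n. v i)"

lemma abs_le_nrm: "i < n \<Longrightarrow> \<bar>x i\<bar> \<le> nrm n x"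
proof -
  assume "i < n"
  then have "\<bar>x i\<bar> \<le> L2_set (\<lambda>i. \<bar>x i\<bar>) {..<n}" by (intro member_le_L2_set) auto
  then show ?thesis by (simp add: nrm_def L2_set_def)
qed

text \<open>Vectors are functions on all naturals, so the coordinates from \<open>n\<close> on are
  pinned to zero. The sphere is then a closed subset of a product of compact sets.\<close>

lemma compact_unit_sphere:
  "compact {x :: nat \<Rightarrow> real. dot n x x = 1 \<and> (\<forall>i\<ge>n. x i = 0)}"
proof -
  define K :: "nat \<Rightarrow> real set" where "K i = (if i < n then {-1..1} else {0})" for i
  have "compactin (product_topology (\<lambda>_. euclidean) UNIV) (Pi\<^sub>E UNIV K)"
    by (subst compactin_PiE) (auto simp: K_def)
  then have "compact (Pi\<^sub>E UNIV K)"
    by (simp add: euclidean_product_topology)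
  moreover have "closed {x :: nat \<Rightarrow> real. dot n x x = 1}"
    unfolding dot_def by (intro closed_Collect_eq continuous_intros continuous_on_product_coordinates)
  ultimately have "compact (Pi\<^sub>E UNIV K \<inter> {x. dot n x x = 1})" by (rule compact_Int_closed)
  moreover have "Pi\<^sub>E UNIV K \<inter> {x. dot n x x = 1} = {x. dot n x x = 1 \<and> (\<forall>i\<ge>n. x i = 0)}"
  proof -
    have "x i \<in> {-1..1}" if "i < n" "dot n x x = 1" for x i
      using abs_le_nrm[OF that(1), of x] that(2) by (simp add: nrm_eq_sqrt abs_le_iff)
    then show ?thesis by (auto simp: K_def PiE_iff split: if_splits)
  qed
  ultimately show ?thesis by simp
qed

text \<open>A maximiser of the quadratic form on the unit sphere is an eigenvector: its residual
  \<open>z\<close> would otherwise be a direction of ascent.\<close>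

lemma exists_top_pair:
  assumes sym: "\<And>i j. a i j = a j i" and n: "n \<ge> 1"
  obtains v l where "top_pair n a v l"
proof -
  define S :: "(nat \<Rightarrow> real) set" where "S = {x. dot n x x = 1 \<and> (\<forall>i\<ge>n. x i = 0)}"
  define F where "F x = dot n x (mat_app n a x)" for x
  have "(\<lambda>i. if i = 0 then 1 else 0) \<in> S"
    using n by (auto simp: S_def dot_def if_distrib[of "\<lambda>x. x * _"] cong: if_cong)
  then have ne: "S \<noteq> {}" by blast
  have "continuous_on S F"
    unfolding F_def dot_def mat_app_def
    by (intro continuous_intros continuous_on_subset[OF continuous_on_product_coordinates]) auto
  then obtain v where v: "v \<in> S" and max: "\<And>x. x \<in> S \<Longrightarrow> F x \<le> F v"
    using continuous_attains_sup[OF compact_unit_sphere[of n, folded S_def] ne] by blast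
  define l where "l = F v"
  have vv: "dot n v v = 1" using v by (simp add: S_def)
  have ray: "F x \<le> l * dot n x x" for x
  proof (cases "dot n x x = 0")
    case True
    then have "L2_set x {..<n} = 0" by (simp add: nrm_eq_sqrt flip: nrm_def)
    then have "x i = 0" if "i < n" for i using that by (simp add: L2_set_eq_0_iff)
    then have "F x = 0" by (simp add: F_def dot_def)
    with True show ?thesis by simp
  next
    case False
    define c where "c = nrm n x"
    have c: "c > 0" "c\<^sup>2 = dot n x x"
      using False dot_self_nonneg[of n x] by (auto simp: c_def nrm_power2 nrm_eq_sqrt)
    define y where "y = (\<lambda>i. if i < n then (1 / c) * x i else 0)"
    have y: "dot n y y = dot n (\<lambda>i. (1/c) * x i) (\<lambda>i. (1/c) * x i)"
      by (intro dot_cong) (auto simp: y_def)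
    have "dot n y y = 1" unfolding y dot_linear using c(1) by (simp add: c(2)[symmetric] power2_eq_square)
    then have "F y \<le> l" unfolding l_def by (intro max) (auto simp: S_def y_def)
    moreover have "F y = F x / c\<^sup>2"
    proof -
      have "mat_app n a y = mat_app n a (\<lambda>i. (1/c) * x i)" by (intro mat_app_cong) (simp add: y_def)
      then have "F y = dot n (\<lambda>i. (1/c) * x i) (\<lambda>i. (1/c) * mat_app n a x i)"
        unfolding F_def by (intro dot_cong) (simp_all add: y_def flip: mat_app_linear)
      then show ?thesis unfolding dot_linear by (simp add: F_def power2_eq_square)
    qed
    moreover have "dot n x x > 0" using c by (metis zero_less_power)
    ultimately show ?thesis using c(2) by (simp add: pos_divide_le_eq)
  qed
  define z where "z = (\<lambda>i. mat_app n a v i - l * v i)"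
  define D where "D = dot n z z"
  define E where "E = l * D - F z"
  have E: "E \<ge> 0" using ray[of z] by (simp add: E_def D_def)
  have zv: "dot n z (mat_app n a v) - l * dot n z v = D"
    by (simp add: D_def z_def dot_commute algebra_simps)
  \<comment> \<open>first-order optimality of \<open>v\<close> in the direction \<open>z\<close>\<close>
  have "2 * t * D \<le> t\<^sup>2 * E" for t
  proof -
    have "F (\<lambda>i. v i + t * z i) = F v + t * dot n v (mat_app n a z) + t * dot n z (mat_app n a v) + t\<^sup>2 * F z"
      unfolding F_def by (simp add: dot_def mat_app_def algebra_simps sum.distrib sum_distrib_left power2_eq_square)
    also have "dot n v (mat_app n a z) = dot n z (mat_app n a v)"
      by (subst dot_mat_app_sym[OF sym]) (rule dot_commute)
    finally have F: "F (\<lambda>i. v i + t * z i) = l + 2 * t * dot n z (mat_app n a v) + t\<^sup>2 * F z"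
      by (simp add: l_def)
    have "dot n (\<lambda>i. v i + t * z i) (\<lambda>i. v i + t * z i) = 1 + 2 * t * dot n z v + t\<^sup>2 * D"
      by (simp add: vv D_def dot_commute[of n v z] algebra_simps power2_eq_square)
    with ray[of "\<lambda>i. v i + t * z i"]
    have "l + 2 * t * dot n z (mat_app n a v) + t\<^sup>2 * F z \<le> l * (1 + 2 * t * dot n z v + t\<^sup>2 * D)"
      by (simp only: F)
    then have "2 * t * (dot n z (mat_app n a v) - l * dot n z v) \<le> t\<^sup>2 * E"
      by (simp add: E_def algebra_simps)
    then show ?thesis by (simp add: zv)
  qed
  \<comment> \<open>For small positive \<open>t\<close> the linear gain exceeds the quadratic loss
    unless \<open>D = 0\<close>. The step \<open>D / (E + 1)\<close> is small enough, and the added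
    1 guards against \<open>E = 0\<close>.\<close>
  from this[of "D / (E + 1)"] have "2 * D\<^sup>2 / (E + 1) \<le> D\<^sup>2 * E / (E + 1)\<^sup>2"
    by (simp add: power2_eq_square power_divide)
  then have "2 * D\<^sup>2 * (E + 1) \<le> D\<^sup>2 * E"
    using E by (simp add: divide_simps power2_eq_square split: if_splits)
  moreover have "2 * D\<^sup>2 * (E + 1) = 2 * (D\<^sup>2 * E) + 2 * D\<^sup>2" by (simp add: algebra_simps)
  moreover have "0 \<le> D\<^sup>2 * E" using E by simp
  ultimately have "D\<^sup>2 \<le> 0" by linarith
  then have "L2_set z {..<n} = 0" by (simp add: D_def nrm_eq_sqrt flip: nrm_def)
  then have eig: "mat_app n a v i = l * v i" if "i < n" for i
    using that by (simp add: L2_set_eq_0_iff z_def)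
  show ?thesis
  proof (cases "0 \<le> (\<Sum>i<n. v i)")
    case True
    with eig ray vv have "top_pair n a v l" by (simp add: top_pair_def F_def)
    then show ?thesis by (rule that)
  next
    case False
    have "mat_app n a (\<lambda>i. - v i) i = - mat_app n a v i" for i by (simp add: mat_app_def sum_negf)
    moreover have "dot n (\<lambda>i. - v i) (\<lambda>i. - v i) = 1" using vv by (simp add: dot_def)
    ultimately have "top_pair n a (\<lambda>i. - v i) l" using False eig ray
      by (simp add: top_pair_def F_def sum_negf)
    then show ?thesis by (rule that)
  qed
qed

section \<open>Adjacency matrices as functions of two indices\<close>

definition adj :: "nat set set \<Rightarrow> nat \<Rightarrow> nat \<Rightarrow> real" where
  "adj H i j = of_bool ({i, j} \<in> H)"

definition centered :: "real \<Rightarrow> nat set set \<Rightarrow> nat \<Rightarrow> nat \<Rightarrow> real" where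
  "centered p H i j = adj H i j - p"

definition flat_vec :: "nat \<Rightarrow> nat \<Rightarrow> real" where
  "flat_vec n i = 1 / sqrt (real n)"

lemma adj_sym: "adj H i j = adj H j i"
  by (simp add: adj_def insert_commute)

lemma centered_sym: "centered p H i j = centered p H j i"
  by (simp add: centered_def adj_sym)

lemma adjacency_matrix_mult_vec:
  assumes v: "v \<in> carrier_vec n" and i: "i < n"
  shows "vec_index (mult_mat_vec (adjacency_matrix n H) v) i = mat_app n (adj H) (vec_index v) i"
proof -
  have "vec_index (mult_mat_vec (adjacency_matrix n H) v) i =
      (\<Sum>j<n. vec_index (row (adjacency_matrix n H) i) j * vec_index v j)"
    using v i by (simp add: adjacency_matrix_def scalar_prod_def atLeast0LessThan)
  also have "\<dots> = mat_app n (adj H) (vec_index v) i"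
    unfolding mat_app_def
    by (intro sum.cong refl) (use i in \<open>auto simp: adjacency_matrix_def adj_def\<close>)
  finally show ?thesis .
qed

lemma dim_adjacency_matrix [simp]:
  "dim_row (adjacency_matrix n H) = n" "dim_col (adjacency_matrix n H) = n"
  by (simp_all add: adjacency_matrix_def)

text \<open>The largest eigenvalue dominates every Rayleigh quotient because the maximum of the
  quotient is itself an eigenvalue, attained by the vector from
  \<open>exists_top_pair\<close>.\<close>

lemma normalized_top_eigenvector_top_pair:
  assumes v: "normalized_top_eigenvector (adjacency_matrix n H) v" and n: "n \<ge> 1"
  obtains l where "top_pair n (adj H) (vec_index v) l"
proof -
  let ?A = "adjacency_matrix n H"
  from v obtain k where k: "largest_eigenvalue ?A k" and ev: "eigenvector ?A v k"
    by (auto simp: normalized_top_eigenvector_def)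
  have vc: "v \<in> carrier_vec n" and kv: "mult_mat_vec ?A v = smult_vec k v"
    using ev by (auto simp: eigenvector_def)
  then have dim: "dim_vec v = n" by simp
  have eig: "mat_app n (adj H) (vec_index v) i = k * vec_index v i" if "i < n" for i
    using adjacency_matrix_mult_vec[OF vc that, of H] that dim unfolding kv by simp
  obtain u l where u: "top_pair n (adj H) u l"
    by (rule exists_top_pair[where a = "adj H" and n = n, OF adj_sym n])
  have "eigenvector ?A (Matrix.vec n u) l"
    unfolding eigenvector_def
  proof (intro conjI)
    show "Matrix.vec n u \<in> carrier_vec (dim_row ?A)" by simp
    show "Matrix.vec n u \<noteq> 0\<^sub>v (dim_row ?A)"
    proof
      assume eq: "Matrix.vec n u = 0\<^sub>v (dim_row ?A)"
      have "u i = 0" if "i < n" for i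
        using arg_cong[OF eq, of "\<lambda>x. vec_index x i"] that by simp
      then have "dot n u u = 0" by (simp add: dot_def)
      with u show False by (simp add: top_pair_def)
    qed
    show "mult_mat_vec ?A (Matrix.vec n u) = smult_vec l (Matrix.vec n u)"
    proof (rule eq_vecI)
      fix i assume "i < dim_vec (smult_vec l (Matrix.vec n u))"
      then have i: "i < n" by simp
      have "vec_index (mult_mat_vec ?A (Matrix.vec n u)) i = mat_app n (adj H) (vec_index (Matrix.vec n u)) i"
        by (rule adjacency_matrix_mult_vec) (use i in simp_all)
      also have "mat_app n (adj H) (vec_index (Matrix.vec n u)) = mat_app n (adj H) u"
        by (intro mat_app_cong) simp
      also have "mat_app n (adj H) u i = l * u i" using u i by (simp add: top_pair_def)
      finally show "vec_index (mult_mat_vec ?A (Matrix.vec n u)) i =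
          vec_index (smult_vec l (Matrix.vec n u)) i" using i by simp
    qed simp
  qed
  then have "l \<le> k" using k by (auto simp: largest_eigenvalue_def eigenvalue_def)
  have ray: "dot n x (mat_app n (adj H) x) \<le> k * dot n x x" for x
  proof -
    have "dot n x (mat_app n (adj H) x) \<le> l * dot n x x" using u by (simp add: top_pair_def)
    also have "\<dots> \<le> k * dot n x x" by (rule mult_right_mono[OF \<open>l \<le> k\<close> dot_self_nonneg])
    finally show ?thesis .
  qed
  have "dot n (vec_index v) (vec_index v) = 1" "0 \<le> (\<Sum>i<n. vec_index v i)"
    using v dim by (auto simp: normalized_top_eigenvector_def sum_power2_eq_dot)
  with eig ray have "top_pair n (adj H) (vec_index v) k" by (simp add: top_pair_def)
  then show ?thesis by (rule that)
qed

lemma dot_flat_flat: "n \<ge> 1 \<Longrightarrow> dot n (flat_vec n) (flat_vec n) = 1"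
  by (simp add: dot_def flat_vec_def)

lemma dot_flat: "dot n (flat_vec n) x = (\<Sum>i<n. x i) / sqrt (real n)"
  by (simp add: dot_def flat_vec_def sum_divide_distrib)

text \<open>Loops have the same probability as other edges, so centring subtracts exactly the
  constant matrix with entries \<open>p\<close>, which is \<open>n * p\<close> times the projection
  onto the flat vector.\<close>

lemma mat_app_adj:
  assumes "n \<ge> 1"
  shows "mat_app n (adj H) x i = mat_app n (centered p H) x i + (real n * p) * dot n (flat_vec n) x * flat_vec n i"
proof -
  have "mat_app n (adj H) x i = mat_app n (centered p H) x i + p * (\<Sum>j<n. x j)"
    by (simp add: mat_app_def centered_def algebra_simps sum_subtractf sum_distrib_left)
  also have "p * (\<Sum>j<n. x j) = (real n * p) * dot n (flat_vec n) x * flat_vec n i"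
    using assms by (simp add: dot_flat) (simp add: flat_vec_def)
  finally show ?thesis .
qed

text \<open>\<open>K\<close> measures the slack. The squares in the last two clauses have mean at
  most \<open>n * p\<close> and \<open>2 * p\<close>, so Markov's inequality makes each of them fail
  with probability of order \<open>1 / K\<close>.\<close>

definition regular :: "nat \<Rightarrow> real \<Rightarrow> real \<Rightarrow> nat set set \<Rightarrow> bool" where
  "regular n p K H \<longleftrightarrow>
     (\<forall>x. nrm n (mat_app n (centered p H) x) \<le> real n * p / K * nrm n x) \<and>
     (nrm n (mat_app n (centered p H) (flat_vec n)))\<^sup>2 \<le> K * (real n * p) \<and>
     (dot n (flat_vec n) (mat_app n (centered p H) (flat_vec n)))\<^sup>2 \<le> K"

definition remainder :: "nat \<Rightarrow> real \<Rightarrow> nat set set \<Rightarrow> (nat \<Rightarrow> real) \<Rightarrow> nat \<Rightarrow> real" where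
  "remainder n p H v i = v i - flat_vec n i - mat_app n (centered p H) (flat_vec n) i / (real n * p)"

section \<open>Deterministic consequences of regularity\<close>

context
  fixes n :: nat and p K :: real and H :: "nat set set"
  assumes n: "n \<ge> 1" and p: "p > 0" and K: "K \<ge> 8" and reg: "regular n p K H"
begin

private lemma small: "real n * p / K \<le> real n * p / 8"
  using n p K by (intro divide_left_mono) auto

private lemma top_pair_facts:
  assumes "top_pair n (adj H) v l"
  shows "dot n v v = 1" and "dot n (flat_vec n) v \<ge> 0"
    and "\<And>i. i < n \<Longrightarrow> mat_app n (centered p H) v i + (real n * p) * dot n (flat_vec n) v * flat_vec n i = l * v i"
    and "real n * p + dot n (flat_vec n) (mat_app n (centered p H) (flat_vec n)) \<le> l"
proof -
  show "dot n v v = 1" "dot n (flat_vec n) v \<ge> 0"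
    using assms by (auto simp: top_pair_def dot_flat)
  show "mat_app n (centered p H) v i + (real n * p) * dot n (flat_vec n) v * flat_vec n i = l * v i" if "i < n" for i
  proof -
    have "mat_app n (adj H) v i = l * v i" using assms that by (simp add: top_pair_def)
    then show ?thesis using mat_app_adj[OF n, of H v i p] by simp
  qed
  have "dot n (flat_vec n) (mat_app n (adj H) (flat_vec n)) \<le> l"
    using assms unfolding top_pair_def by (metis dot_flat_flat[OF n] mult.right_neutral)
  moreover have "mat_app n (adj H) (flat_vec n) = (\<lambda>i. mat_app n (centered p H) (flat_vec n) i + (real n * p) * flat_vec n i)"
    by (rule ext) (simp add: mat_app_adj[OF n, of H _ _ p] dot_flat_flat[OF n])
  ultimately show "real n * p + dot n (flat_vec n) (mat_app n (centered p H) (flat_vec n)) \<le> l"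
    by (simp add: dot_flat_flat[OF n])
qed

private lemmas expansion = top_eigenvector_expansion
  [where w = "centered p H" and e = "flat_vec n" and d = "real n * p" and s = "real n * p / K" and n = n,
   OF centered_sym _ dot_flat_flat[OF n] _ _ _ _ _ small]

private lemma op: "nrm n (mat_app n (centered p H) x) \<le> real n * p / K * nrm n x"
  using reg by (simp add: regular_def)

private lemma np: "real n * p > 0"
  using n p by simp

text \<open>Comparing Rayleigh quotients gives equal eigenvalues. The combination
  \<open>c' v - c v'\<close> is orthogonal to the flat vector, so the rank-one part does not see it
  and it satisfies \<open>W u = l u\<close>; as \<open>l\<close> exceeds the bound on the norm of
  \<open>W\<close>, it vanishes. Unit length and positive overlaps then give
  \<open>c = c'\<close>.\<close>

lemma top_pair_unique:
  assumes v: "top_pair n (adj H) v l" and v': "top_pair n (adj H) v' l'" and i: "i < n"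
  shows "v i = v' i"
proof -
  note f = top_pair_facts[OF v] and f' = top_pair_facts[OF v']
  define c where "c = dot n (flat_vec n) v"
  define c' where "c' = dot n (flat_vec n) v'"
  have c: "c > 0"
    unfolding c_def by (rule expansion(1)[OF op f(1,2) _ f(4) np]) (rule f(3))
  have sl: "real n * p / K < l"
    by (rule expansion(2)[OF op f(1,2) _ f(4) np]) (rule f(3))
  have c': "c' > 0"
    unfolding c'_def by (rule expansion(1)[OF op f'(1,2) _ f'(4) np]) (rule f'(3))
  have rayleigh: "dot n x (mat_app n (adj H) x) = m" if "top_pair n (adj H) x m" for x m
  proof -
    have "dot n x (mat_app n (adj H) x) = dot n x (\<lambda>i. m * x i)"
      using that by (intro dot_cong) (auto simp: top_pair_def)
    then show ?thesis using that by (simp add: top_pair_def)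
  qed
  have "l \<le> l'" "l' \<le> l"
  proof -
    have "dot n x (mat_app n (adj H) x) \<le> m" if "top_pair n (adj H) y m" "dot n x x = 1" for x y m
      using that unfolding top_pair_def by (metis mult.right_neutral)
    from this[OF v' f(1)] this[OF v f'(1)] show "l \<le> l'" "l' \<le> l"
      by (simp_all only: rayleigh[OF v] rayleigh[OF v'])
  qed
  then have ll: "l' = l" by simp
  define u where "u = (\<lambda>i. c' * v i - c * v' i)"
  have eu: "dot n (flat_vec n) u = 0" by (simp add: u_def flip: c_def c'_def)
  have "mat_app n (centered p H) u i = l * u i" if "i < n" for i
  proof -
    have "mat_app n (adj H) u i = l * u i"
    proof -
      have "mat_app n (adj H) v i = l * v i" "mat_app n (adj H) v' i = l * v' i"
        using v v' that ll by (auto simp: top_pair_def)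
      then show ?thesis unfolding u_def mat_app_linear by (simp add: algebra_simps)
    qed
    then show ?thesis using mat_app_adj[OF n, of H u i p] eu by simp
  qed
  then have "nrm n (mat_app n (centered p H) u) = \<bar>l\<bar> * nrm n u"
    by (subst nrm_scale[symmetric], intro nrm_cong)
  moreover have "0 \<le> real n * p / K" using np K by simp
  ultimately have "(l - real n * p / K) * nrm n u \<le> 0" using op[of u] sl by (simp add: algebra_simps)
  with sl have "nrm n u \<le> 0" by (simp add: mult_le_0_iff)
  then have "nrm n u = 0" by (simp add: antisym)
  then have eq: "c' * v i = c * v' i" if "i < n" for i
    using that by (simp add: nrm_def L2_set_eq_0_iff u_def)
  have "c'\<^sup>2 = dot n (\<lambda>i. c' * v i) (\<lambda>i. c' * v i)" using f(1) by (simp add: power2_eq_square)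
  also have "\<dots> = dot n (\<lambda>i. c * v' i) (\<lambda>i. c * v' i)" by (intro dot_cong eq)
  also have "\<dots> = c\<^sup>2" using f'(1) by (simp add: power2_eq_square)
  finally have "c' = c" using c c' by (simp add: power2_eq_iff)
  with eq[OF i] c show ?thesis by simp
qed

text \<open>This inserts \<open>s = d / K\<close>, \<open>b \<le> sqrt (K * d)\<close> and
  \<open>\<bar>q\<bar> \<le> sqrt K \<le> K\<close> into the expansion. The constant 10 is the sum
  of the coefficients 7 and 3 found there.\<close>

lemma remainder_le:
  assumes v: "top_pair n (adj H) v l"
  shows "real n * p * (\<Sum>i<n. (remainder n p H v i)\<^sup>2) \<le>
           (10 * K / sqrt (real n * p) + 2 / sqrt K)\<^sup>2"
proof -
  note f = top_pair_facts[OF v]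
  define d where "d = real n * p"
  define g where "g = mat_app n (centered p H) (flat_vec n)"
  define R where "R = nrm n (remainder n p H v)"
  have d: "d > 0" using np by (simp add: d_def)
  have "d\<^sup>2 * nrm n (\<lambda>i. v i - flat_vec n i - g i / d) \<le>
          7 * (nrm n g)\<^sup>2 + 3 * d * \<bar>dot n (flat_vec n) g\<bar> + 2 * (d / K) * nrm n g"
    unfolding d_def g_def by (rule expansion(3)[OF op f(1,2) _ f(4) np]) (rule f(3))
  then have main: "d\<^sup>2 * R \<le> 7 * (nrm n g)\<^sup>2 + 3 * d * \<bar>dot n (flat_vec n) g\<bar> + 2 * (d / K) * nrm n g"
    by (simp add: R_def remainder_def[abs_def] d_def g_def)
  have b: "(nrm n g)\<^sup>2 \<le> K * d" and q: "(dot n (flat_vec n) g)\<^sup>2 \<le> K"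
    using reg by (simp_all add: regular_def g_def d_def)
  have b': "nrm n g \<le> sqrt K * sqrt d"
    using b by (simp add: real_le_rsqrt flip: real_sqrt_mult)
  have q': "\<bar>dot n (flat_vec n) g\<bar> \<le> K"
  proof -
    have "\<bar>dot n (flat_vec n) g\<bar> \<le> sqrt K" using q real_le_rsqrt[of "\<bar>dot n (flat_vec n) g\<bar>" K] by simp
    also have "sqrt K \<le> K" using K by (intro real_le_lsqrt) (auto simp: power2_eq_square mult_le_cancel_left1)
    finally show ?thesis .
  qed
  have "d\<^sup>2 * R \<le> 7 * (K * d) + 3 * d * K + 2 * (d / K) * (sqrt K * sqrt d)"
    by (rule order_trans[OF main], intro add_mono mult_left_mono b q' b') (use d K in auto)
  also have "\<dots> = d * (10 * K + 2 * sqrt d / sqrt K)"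
  proof -
    have "sqrt K / K = 1 / sqrt K" using K by (simp add: sqrt_divide_self_eq inverse_eq_divide)
    moreover have "(d / K) * (sqrt K * sqrt d) = d * sqrt d * (sqrt K / K)" by simp
    ultimately have "(d / K) * (sqrt K * sqrt d) = d * (sqrt d / sqrt K)" by simp
    then show ?thesis by (simp only: distrib_left mult.assoc) simp
  qed
  finally have "d * R \<le> 10 * K + 2 * sqrt d / sqrt K" using d by (simp add: power2_eq_square mult.assoc)
  also have "\<dots> = sqrt d * (10 * K / sqrt d + 2 / sqrt K)"
    using d by (simp add: field_simps)
  also have "d * R = sqrt d * (sqrt d * R)" using d by simp
  finally have "sqrt d * R \<le> 10 * K / sqrt d + 2 / sqrt K"
    by (rule mult_left_le_imp_le) (use d in simp)
  then have "(sqrt d * R)\<^sup>2 \<le> (10 * K / sqrt d + 2 / sqrt K)\<^sup>2"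
    using d by (intro power_mono) (auto simp: R_def)
  then show ?thesis using d
    by (simp add: power_mult_distrib R_def nrm_power2 d_def sum_power2_eq_dot)
qed

end

section \<open>The law of the random graph\<close>

definition graph_weight :: "nat \<Rightarrow> real \<Rightarrow> nat set set \<Rightarrow> real" where
  "graph_weight n p H = p ^ card H * (1 - p) ^ (card (vertex_pairs n) - card H)"

text \<open>Expectation under the law of the graph, as a finite sum free of measurability questions.
  Values in a real vector space cover both real moments and complex characteristic
  functions.\<close>

definition graph_exp :: "nat \<Rightarrow> real \<Rightarrow> (nat set set \<Rightarrow> 'a::real_vector) \<Rightarrow> 'a" where
  "graph_exp n p f = (\<Sum>H\<in>Pow (vertex_pairs n). graph_weight n p H *\<^sub>R f H)"

lemma finite_vertex_pairs [simp]: "finite (vertex_pairs n)"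
proof -
  have "vertex_pairs n = (\<lambda>(i, j). {i, j}) ` ({..<n} \<times> {..<n})"
    by (auto simp: vertex_pairs_def)
  then show ?thesis by simp
qed

lemma pair_in_vertex_pairs [intro, simp]: "i < n \<Longrightarrow> j < n \<Longrightarrow> {i, j} \<in> vertex_pairs n"
  by (auto simp: vertex_pairs_def)

lemma prod_bool_pred:
  fixes g :: "'a \<Rightarrow> bool \<Rightarrow> 'b :: comm_monoid_mult"
  assumes "finite V" "H \<subseteq> V"
  shows "(\<Prod>e\<in>V. g e (e \<in> H)) = (\<Prod>e\<in>H. g e True) * (\<Prod>e\<in>V - H. g e False)"
proof -
  have "(\<Prod>e\<in>V. g e (e \<in> H)) = (\<Prod>e\<in>V - H. g e (e \<in> H)) * (\<Prod>e\<in>H. g e (e \<in> H))"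
    using assms by (intro prod.subset_diff)
  also have "\<dots> = (\<Prod>e\<in>V - H. g e False) * (\<Prod>e\<in>H. g e True)"
    by (intro arg_cong2[where f = "(*)"] prod.cong) auto
  finally show ?thesis by (simp add: mult.commute)
qed

lemma graph_weight_eq_prod: "H \<subseteq> vertex_pairs n \<Longrightarrow> graph_weight n p H = (\<Prod>e\<in>vertex_pairs n. if e \<in> H then p else 1 - p)"
  using prod_bool_pred[of "vertex_pairs n" H "\<lambda>_ b. if b then p else 1 - p"]
  by (simp add: graph_weight_def card_Diff_subset finite_subset)

text \<open>Independence of the edges in computational form: multiplying out the right-hand product
  selects, for each edge, presence or absence, hence a subgraph together with its weight.\<close>

lemma graph_exp_prod:
  fixes g :: "nat set \<Rightarrow> bool \<Rightarrow> 'a :: {real_algebra_1, comm_ring_1}"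
  shows "graph_exp n p (\<lambda>H. \<Prod>e\<in>vertex_pairs n. g e (e \<in> H)) =
           (\<Prod>e\<in>vertex_pairs n. p *\<^sub>R g e True + (1 - p) *\<^sub>R g e False)"
proof -
  let ?V = "vertex_pairs n"
  have "(\<Prod>e\<in>?V. p *\<^sub>R g e True + (1 - p) *\<^sub>R g e False) =
          (\<Sum>H\<in>Pow ?V. (\<Prod>e\<in>H. p *\<^sub>R g e True) * (\<Prod>e\<in>?V - H. (1 - p) *\<^sub>R g e False))"
    by (rule prod_add) simp
  also have "\<dots> = graph_exp n p (\<lambda>H. \<Prod>e\<in>?V. g e (e \<in> H))"
    unfolding graph_exp_def
  proof (intro sum.cong refl)
    fix H assume "H \<in> Pow ?V"
    then have H: "H \<subseteq> ?V" by simp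
    then show "(\<Prod>e\<in>H. p *\<^sub>R g e True) * (\<Prod>e\<in>?V - H. (1 - p) *\<^sub>R g e False) =
        graph_weight n p H *\<^sub>R (\<Prod>e\<in>?V. g e (e \<in> H))"
      by (simp add: prod_bool_pred[OF _ H] graph_weight_def card_Diff_subset finite_subset
          scaleR_conv_of_real prod.distrib mult_ac)
  qed
  finally show ?thesis by simp
qed

lemma graph_exp_add: "graph_exp n p (\<lambda>H. f H + g H) = graph_exp n p f + graph_exp n p g"
  by (simp add: graph_exp_def scaleR_add_right sum.distrib)

lemma graph_exp_sum: "graph_exp n p (\<lambda>H. \<Sum>x\<in>A. f x H) = (\<Sum>x\<in>A. graph_exp n p (f x))"
  unfolding graph_exp_def scaleR_sum_right by (rule sum.swap)

lemma graph_exp_cmult: "graph_exp n p (\<lambda>H. c * f H) = c * (graph_exp n p f :: real)"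
  by (simp add: graph_exp_def sum_distrib_left mult.left_commute)

lemma graph_weight_nonneg: "0 \<le> p \<Longrightarrow> p \<le> 1 \<Longrightarrow> 0 \<le> graph_weight n p H"
  by (simp add: graph_weight_def)

lemma graph_exp_mono:
  fixes f g :: "nat set set \<Rightarrow> real"
  assumes "0 \<le> p" "p \<le> 1" "\<And>H. H \<subseteq> vertex_pairs n \<Longrightarrow> f H \<le> g H"
  shows "graph_exp n p f \<le> graph_exp n p g"
  unfolding graph_exp_def using assms by (intro sum_mono) (auto intro!: mult_left_mono simp: graph_weight_nonneg)

lemma graph_exp_const: "graph_exp n p (\<lambda>_. c) = (c :: real)"
proof -
  have "graph_exp n p (\<lambda>H. \<Prod>e\<in>vertex_pairs n. 1 :: real) = 1"
    by (subst graph_exp_prod) simp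
  then show ?thesis using graph_exp_cmult[of n p c "\<lambda>_. 1"] by simp
qed

lemma graph_exp_markov:
  fixes f :: "nat set set \<Rightarrow> real"
  assumes p: "0 \<le> p" "p \<le> 1" and f: "\<And>H. 0 \<le> f H" and c: "c > 0"
  shows "graph_exp n p (\<lambda>H. of_bool (\<not> f H \<le> c)) \<le> graph_exp n p f / c"
proof -
  have "graph_exp n p (\<lambda>H. of_bool (\<not> f H \<le> c)) \<le> graph_exp n p (\<lambda>H. (1 / c) * f H)"
    using f c by (intro graph_exp_mono p) (auto simp: field_simps of_bool_def)
  then show ?thesis unfolding graph_exp_cmult by simp
qed

section \<open>From the probability space to the finite law\<close>

context erdos_renyi_graph
begin

lemma p_bounds: assumes "n \<ge> 1" shows "0 \<le> p" "p \<le> 1"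
proof -
  have "{0, 0} \<in> vertex_pairs n" by (rule pair_in_vertex_pairs) (use assms in auto)
  note prob_edge[OF this, symmetric]
  then show "0 \<le> p" "p \<le> 1" by (simp_all only: measure_nonneg prob_le_1)
qed

lemma edge_event: "e \<in> vertex_pairs n \<Longrightarrow> {\<omega> \<in> space M. e \<in> G \<omega>} \<in> events"
  using indep_edges by (auto simp: indep_events_def)

lemma graph_event:
  assumes "n \<ge> 1" "H \<subseteq> vertex_pairs n"
  shows "{\<omega> \<in> space M. G \<omega> = H} \<in> events" "prob {\<omega> \<in> space M. G \<omega> = H} = graph_weight n p H"
proof -
  let ?V = "vertex_pairs n" and ?E = "\<lambda>e. {\<omega> \<in> space M. e \<in> G \<omega>}"
  define A where "A e = (if e \<in> H then ?E e else space M - ?E e)" for e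
  \<comment> \<open>A nonempty index set keeps the intersection of the \<open>A e\<close> inside the
    sample space and is required by the product rule for independent sets.\<close>
  have V: "?V \<noteq> {}" using pair_in_vertex_pairs[of 0 n 0] assms(1) by auto
  have eq: "{\<omega> \<in> space M. G \<omega> = H} = (\<Inter>e\<in>?V. A e)"
  proof (intro equalityI subsetI)
    fix \<omega> assume "\<omega> \<in> {\<omega> \<in> space M. G \<omega> = H}"
    then have "\<omega> \<in> space M" "G \<omega> = H" by auto
    then show "\<omega> \<in> (\<Inter>e\<in>?V. A e)" unfolding A_def by (intro INT_I) simp
  next
    fix \<omega> assume \<omega>: "\<omega> \<in> (\<Inter>e\<in>?V. A e)"
    obtain e where "e \<in> ?V" using V by blast
    with \<omega> have "\<omega> \<in> A e" by blast
    then have sp: "\<omega> \<in> space M" by (auto simp: A_def split: if_splits)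
    have iff: "e \<in> G \<omega> \<longleftrightarrow> e \<in> H" if e: "e \<in> ?V" for e
    proof -
      have "\<omega> \<in> A e" using \<omega> e by blast
      then show ?thesis using sp by (simp add: A_def split: if_splits)
    qed
    have "G \<omega> = H"
    proof (rule Set.set_eqI)
      fix e show "e \<in> G \<omega> \<longleftrightarrow> e \<in> H"
      proof (cases "e \<in> ?V")
        case False
        then show ?thesis using assms(2) edges_subset[OF sp] by (meson subsetD)
      qed (rule iff)
    qed
    then show "\<omega> \<in> {\<omega> \<in> space M. G \<omega> = H}" using sp by simp
  qed
  \<comment> \<open>Absent edges contribute complements of the given events, so independence is
    first extended to the generated sigma-algebras.\<close>
  have "indep_sets (\<lambda>e. sigma_sets (space M) {?E e}) ?V"
    using indep_edges unfolding indep_events_def_alt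
    by (intro indep_sets_sigma) (auto simp: Int_stable_def)
  then have "prob (\<Inter>e\<in>?V. A e) = (\<Prod>e\<in>?V. prob (A e))"
    by (rule indep_setsD[OF _ subset_refl V]) (auto simp: A_def intro: sigma_sets.intros)
  also have "\<dots> = (\<Prod>e\<in>?V. if e \<in> H then p else 1 - p)"
    by (intro prod.cong refl) (auto simp: A_def prob_edge prob_compl[OF edge_event])
  finally show "prob {\<omega> \<in> space M. G \<omega> = H} = graph_weight n p H"
    by (simp add: eq graph_weight_eq_prod[OF assms(2)])
  show "{\<omega> \<in> space M. G \<omega> = H} \<in> events"
    unfolding eq using V by (intro sets.finite_INT) (auto simp: A_def edge_event)
qed

text \<open>The random graph takes finitely many values, so any function of it is a finite
  combination of indicators of the events in \<open>graph_event\<close>.\<close>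

lemma
  fixes f :: "nat set set \<Rightarrow> 'b :: {banach, second_countable_topology}"
  assumes n: "n \<ge> 1"
  shows integrable_graph: "integrable M (\<lambda>\<omega>. f (G \<omega>))"
    and expectation_graph: "expectation (\<lambda>\<omega>. f (G \<omega>)) = graph_exp n p f"
proof -
  let ?S = "\<lambda>\<omega>. \<Sum>H\<in>Pow (vertex_pairs n). indicat_real {\<omega> \<in> space M. G \<omega> = H} \<omega> *\<^sub>R f H"
  have eq: "f (G \<omega>) = ?S \<omega>" if "\<omega> \<in> space M" for \<omega>
  proof -
    have "?S \<omega> = (\<Sum>H\<in>Pow (vertex_pairs n). if H = G \<omega> then f H else 0)"
      using that by (intro sum.cong) (auto simp: indicator_def)
    then show ?thesis using edges_subset[OF that] by simp
  qed
  have "has_bochner_integral M (\<lambda>\<omega>. indicat_real {\<omega> \<in> space M. G \<omega> = H} \<omega> *\<^sub>R f H) (graph_weight n p H *\<^sub>R f H)"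
    if "H \<in> Pow (vertex_pairs n)" for H
  proof (rule has_bochner_integral_scaleR_left)
    have H: "H \<subseteq> vertex_pairs n" using that by simp
    show "has_bochner_integral M (indicat_real {\<omega> \<in> space M. G \<omega> = H}) (graph_weight n p H)"
      unfolding graph_event(2)[OF n H, symmetric]
      by (rule has_bochner_integral_real_indicator[OF graph_event(1)[OF n H]])
         (simp add: emeasure_eq_measure)
  qed
  then have "has_bochner_integral M ?S (graph_exp n p f)"
    unfolding graph_exp_def by (rule has_bochner_integral_sum)
  then have "has_bochner_integral M (\<lambda>\<omega>. f (G \<omega>)) (graph_exp n p f)"
    by (subst has_bochner_integral_cong[where N = M and g = ?S and y = "graph_exp n p f"]) (auto simp only: eq)
  then show "integrable M (\<lambda>\<omega>. f (G \<omega>))" "expectation (\<lambda>\<omega>. f (G \<omega>)) = graph_exp n p f"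
    by (auto simp: has_bochner_integral_iff)
qed

end

section \<open>Moments of the centred adjacency matrix\<close>

text \<open>The left side is a central moment of a Bernoulli variable. The centred values lie in
  \<open>[-1, 1]\<close>, so higher moments are dominated by the variance
  \<open>p - p\<^sup>2\<close>.\<close>

lemma power_bernoulli_centered_le:
  fixes p :: real
  assumes "0 \<le> p" "p \<le> 1" "c \<ge> 2"
  shows "\<bar>p * (1 - p) ^ c + (1 - p) * (- p) ^ c\<bar> \<le> p"
proof -
  have "\<bar>p * (1 - p) ^ c + (1 - p) * (- p) ^ c\<bar> \<le> p * (1 - p) ^ c + (1 - p) * p ^ c"
    using assms abs_triangle_ineq[of "p * (1 - p) ^ c" "(1 - p) * (- p) ^ c"]
    by (simp add: abs_mult power_abs)
  also have "\<dots> \<le> p * (1 - p)\<^sup>2 + (1 - p) * p\<^sup>2"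
    using assms by (intro add_mono mult_left_mono power_decreasing) auto
  also have "\<dots> = p - p\<^sup>2"
    by (simp add: power2_eq_square algebra_simps)
  also have "\<dots> \<le> p" by simp
  finally show ?thesis .
qed

text \<open>Collecting repeated entries turns the product into independent factors. An edge
  occurring once contributes a centred mean, which is zero; every other edge of the list contributes
  at most \<open>p\<close>.\<close>

lemma graph_exp_prod_list_centered:
  assumes p: "0 \<le> p" "p \<le> 1" and es: "set es \<subseteq> vertex_pairs n"
  shows "\<bar>graph_exp n p (\<lambda>H. \<Prod>e\<leftarrow>es. of_bool (e \<in> H) - p)\<bar> \<le>
           of_bool (\<forall>e\<in>set es. count_list es e \<ge> 2) * p ^ card (set es)"
proof -
  let ?V = "vertex_pairs n"
  define c where "c = count_list es"
  define F where "F e = p * (1 - p) ^ c e + (1 - p) * (- p) ^ c e" for e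
  have list: "(\<Prod>e\<leftarrow>es. f e) = (\<Prod>e\<in>?V. f e ^ c e)" for f :: "nat set \<Rightarrow> real"
    unfolding c_def using es
  proof (induction es)
    case (Cons e es)
    then have e: "e \<in> ?V" by simp
    have "(\<Prod>x\<in>?V. f x ^ count_list (e # es) x) =
            (\<Prod>x\<in>?V. f x ^ count_list es x * (if x = e then f x else 1))"
      by (intro prod.cong) auto
    also have "\<dots> = (\<Prod>x\<in>?V. f x ^ count_list es x) * f e"
      using e by (simp add: prod.distrib)
    finally show ?case using Cons by simp
  qed simp
  have "graph_exp n p (\<lambda>H. \<Prod>e\<leftarrow>es. of_bool (e \<in> H) - p) = (\<Prod>e\<in>?V. F e)"
    unfolding list graph_exp_prod[of n p "\<lambda>e b. (of_bool b - p) ^ c e"] by (simp add: F_def)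
  \<comment> \<open>Edges outside the list have exponent zero and factor
    \<open>p + (1 - p) = 1\<close>.\<close>
  also have "\<dots> = (\<Prod>e\<in>set es. F e)"
    using es by (intro prod.mono_neutral_right) (auto simp: F_def c_def)
  finally have eq: "graph_exp n p (\<lambda>H. \<Prod>e\<leftarrow>es. of_bool (e \<in> H) - p) = (\<Prod>e\<in>set es. F e)" .
  show ?thesis
  proof (cases "\<forall>e\<in>set es. c e \<ge> 2")
    case True
    then have "(\<Prod>e\<in>set es. \<bar>F e\<bar>) \<le> (\<Prod>e\<in>set es. p)"
      by (intro prod_mono) (auto simp: F_def intro!: power_bernoulli_centered_le p)
    with True show ?thesis by (simp add: eq abs_prod c_def)
  next
    case False
    then obtain e where e: "e \<in> set es" "c e < 2" by force
    then have "c e = 1" by (simp add: c_def) (metis count_list_0_iff less_2_cases One_nat_def)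
    then have "F e = 0" by (simp add: F_def)
    with e have zero: "(\<Prod>e\<in>set es. F e) = 0" by auto
    show ?thesis unfolding eq zero using p by simp
  qed
qed

section \<open>Counting walks with repeated edges\<close>

definition walk_edges :: "nat list \<Rightarrow> nat set list" where
  "walk_edges xs = map (\<lambda>(i, j). {i, j}) (zip xs (tl xs))"

lemma walk_edges_simps [simp]:
  "walk_edges [] = []" "walk_edges [x] = []"
  "walk_edges (x # y # xs) = {x, y} # walk_edges (y # xs)"
  by (simp_all add: walk_edges_def)

lemma length_walk_edges [simp]: "length (walk_edges xs) = length xs - 1"
  by (simp add: walk_edges_def)

lemma walk_edge_subset: "e \<in> set (walk_edges xs) \<Longrightarrow> e \<subseteq> set xs"
  by (auto simp: walk_edges_def dest: set_zip_leftD set_zip_rightD list.set_sel(2))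
     (metis list.sel(2) list.set_sel(2) set_zip_rightD empty_iff list.set(1))+

lemma set_walk_edges_subset: "set xs \<subseteq> {..<n} \<Longrightarrow> set (walk_edges xs) \<subseteq> vertex_pairs n"
proof (induction xs rule: induct_list012)
  case (3 x y zs)
  then show ?case by auto
qed auto

text \<open>A first vertex that does not recur later brings with it an edge that does not recur
  later either. This is the bound for connected graphs, without spanning trees.\<close>

lemma card_set_le_walk_edges: "card (set xs) \<le> Suc (card (set (walk_edges xs)))"
proof (induction xs rule: induct_list012)
  case (3 x y zs)
  let ?E = "set (walk_edges (y # zs))" and ?S = "set (y # zs)"
  show ?case
  proof (cases "x \<in> ?S")
    case True
    then have "card (set (x # y # zs)) = card ?S" by (metis insert_absorb list.simps(15))
    also have "\<dots> \<le> Suc (card ?E)" by (rule 3)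
    also have "card ?E \<le> card (set (walk_edges (x # y # zs)))" by (intro card_mono) auto
    finally show ?thesis by simp
  next
    case False
    then have "{x, y} \<notin> ?E" using walk_edge_subset[of "{x, y}" "y # zs"] by blast
    then have "card (set (walk_edges (x # y # zs))) = Suc (card ?E)" by simp
    moreover have "card (set (x # y # zs)) = Suc (card ?S)" using False by simp
    ultimately show ?thesis using 3 by simp
  qed
qed auto

lemma walk_prod_centered: "walk_prod (centered p H) xs = (\<Prod>e\<leftarrow>walk_edges xs. of_bool (e \<in> H) - p)"
  by (simp add: walk_prod_def walk_edges_def centered_def adj_def comp_def case_prod_unfold)

text \<open>
  A walk contributes only if every edge on it is traversed at least twice; a walk with \<open>2 k\<close> steps
  then has at most \<open>k\<close> distinct edges and hence at most \<open>k + 1\<close> vertices.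
\<close>

lemma graph_exp_walk_prod_le:
  assumes p: "0 \<le> p" "p \<le> 1" and xs: "xs \<in> walks n (Suc (2 * k))"
  shows "\<bar>graph_exp n p (\<lambda>H. walk_prod (centered p H) xs)\<bar> \<le>
           of_bool (card (set xs) \<le> Suc k) * p ^ (card (set xs) - 1)"
proof -
  let ?es = "walk_edges xs"
  have es: "set ?es \<subseteq> vertex_pairs n"
    using xs by (intro set_walk_edges_subset) (simp add: walks_def)
  have "length xs = Suc (2 * k)" using xs unfolding walks_def by blast
  then have len: "length ?es = 2 * k" by (simp only: length_walk_edges diff_Suc_1)
  have "\<bar>graph_exp n p (\<lambda>H. walk_prod (centered p H) xs)\<bar> \<le>
          of_bool (\<forall>e\<in>set ?es. count_list ?es e \<ge> 2) * p ^ card (set ?es)"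
    unfolding walk_prod_centered by (rule graph_exp_prod_list_centered[OF p es])
  also have "\<dots> \<le> of_bool (card (set xs) \<le> Suc k) * p ^ (card (set xs) - 1)"
  proof (cases "\<forall>e\<in>set ?es. count_list ?es e \<ge> 2")
    case True
    have "2 * card (set ?es) = (\<Sum>e\<in>set ?es. 2)" by simp
    also have "\<dots> \<le> (\<Sum>e\<in>set ?es. count_list ?es e)" using True by (intro sum_mono) auto
    also have "\<dots> = 2 * k" 
      using sum_count_set[of ?es "set ?es"] len by (simp only: subset_refl finite_set)
    finally have "card (set xs) \<le> Suc k" using card_set_le_walk_edges[of xs] by simp
    moreover have "p ^ card (set ?es) \<le> p ^ (card (set xs) - 1)"
      using card_set_le_walk_edges[of xs] p by (intro power_decreasing) auto
    ultimately show ?thesis using True by simp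
  qed (use p in auto)
  finally show ?thesis .
qed

text \<open>A list is recovered from the sorted list of its entries and the positions of its letters
  there. The overcount costs a factor \<open>m\<close> per letter; for \<open>m\<close> of order
  \<open>ln n\<close> this is affordable against a power of \<open>ln n\<close> in
  \<open>n * p\<close>.\<close>

lemma card_walks_card_le: "card {xs \<in> walks n l. card (set xs) = m} \<le> n ^ m * m ^ l"
proof -
  have card: "card (walks n' l') = n' ^ l'" for n' l'
    unfolding walks_def by (subst card_lists_length_eq) auto
  have "{xs \<in> walks n l. card (set xs) = m} \<subseteq> (\<lambda>(f, g). map ((!) f) g) ` (walks n m \<times> walks m l)"
  proof
    fix xs assume "xs \<in> {xs \<in> walks n l. card (set xs) = m}"
    then have xs: "set xs \<subseteq> {..<n}" "length xs = l" "card (set xs) = m" by (auto simp: walks_def)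
    define f where "f = sorted_list_of_set (set xs)"
    have f: "set f = set xs" "length f = m" using xs by (simp_all add: f_def)
    have "\<exists>i. i < m \<and> f ! i = x" if "x \<in> set xs" for x
      using that f by (metis in_set_conv_nth)
    then obtain idx where idx: "\<And>x. x \<in> set xs \<Longrightarrow> idx x < m \<and> f ! idx x = x" by metis
    have "xs = map ((!) f) (map idx xs)" using idx by (simp add: map_idI)
    moreover have "f \<in> walks n m" "map idx xs \<in> walks m l" using f xs idx by (auto simp: walks_def)
    ultimately show "xs \<in> (\<lambda>(f, g). map ((!) f) g) ` (walks n m \<times> walks m l)" by force
  qed
  then have "card {xs \<in> walks n l. card (set xs) = m} \<le> card (walks n m \<times> walks m l)"
    by (intro surj_card_le) auto
  then show ?thesis by (simp add: card_cartesian_product card)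
qed

text \<open>Walks are grouped by their number \<open>m\<close> of distinct vertices; a group
  contributes at most \<open>n * m ^ (2 * k + 1) * (n * p) ^ (m - 1)\<close>.\<close>

lemma graph_exp_frobenius_le:
  assumes p: "0 \<le> p" "p \<le> 1" and np: "1 \<le> real n * p"
  shows "graph_exp n p (\<lambda>H. \<Sum>i<n. \<Sum>j<n. (mpow n (centered p H) k i j)\<^sup>2) \<le>
           real n * real (Suc k) ^ (2 * k + 2) * (real n * p) ^ k"
proof -
  let ?W = "walks n (Suc (2 * k))" and ?b = "\<lambda>xs. of_bool (card (set xs) \<le> Suc k) * p ^ (card (set xs) - 1)"
  have "graph_exp n p (\<lambda>H. \<Sum>i<n. \<Sum>j<n. (mpow n (centered p H) k i j)\<^sup>2) =
          (\<Sum>xs\<in>?W. of_bool (last xs = hd xs) * graph_exp n p (\<lambda>H. walk_prod (centered p H) xs))"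
    unfolding frobenius_mpow_eq_trace[OF centered_sym] trace_mpow_eq_sum_walks graph_exp_sum
    by (simp only: mult.commute[of _ "of_bool _"] graph_exp_cmult)
  also have "\<dots> \<le> (\<Sum>xs\<in>?W. ?b xs)"
  proof (rule sum_mono)
    fix xs assume "xs \<in> ?W"
    then have "\<bar>graph_exp n p (\<lambda>H. walk_prod (centered p H) xs)\<bar> \<le> ?b xs" by (rule graph_exp_walk_prod_le[OF p])
    then show "of_bool (last xs = hd xs) * graph_exp n p (\<lambda>H. walk_prod (centered p H) xs) \<le> ?b xs"
      by (cases "last xs = hd xs") (use p in auto)
  qed
  also have "\<dots> = (\<Sum>xs\<in>{xs \<in> ?W. card (set xs) \<in> {1..Suc k}}. p ^ (card (set xs) - 1))"
  proof (rule sum.mono_neutral_cong_right)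
    show "\<forall>xs\<in>?W - {xs \<in> ?W. card (set xs) \<in> {1..Suc k}}. ?b xs = 0"
    proof
      fix xs assume "xs \<in> ?W - {xs \<in> ?W. card (set xs) \<in> {1..Suc k}}"
      moreover from this have "card (set xs) \<ge> 1" by (auto simp: walks_def Suc_le_eq card_gt_0_iff)
      ultimately show "?b xs = 0" by auto
    qed
  qed auto
  also have "\<dots> = (\<Sum>m\<in>{1..Suc k}. \<Sum>xs\<in>{xs \<in> {xs \<in> ?W. card (set xs) \<in> {1..Suc k}}. card (set xs) = m}. p ^ (card (set xs) - 1))"
    by (rule sum.group[symmetric]) auto
  also have "\<dots> \<le> (\<Sum>m\<in>{1..Suc k}. real n * real (Suc k) ^ Suc (2 * k) * (real n * p) ^ k)"
  proof (rule sum_mono)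
    fix m assume m: "m \<in> {1..Suc k}"
    have "(\<Sum>xs\<in>{xs \<in> {xs \<in> ?W. card (set xs) \<in> {1..Suc k}}. card (set xs) = m}. p ^ (card (set xs) - 1)) =
            (\<Sum>xs\<in>{xs \<in> ?W. card (set xs) = m}. p ^ (m - 1))"
      using m by (intro sum.cong) auto
    also have "\<dots> = real (card {xs \<in> ?W. card (set xs) = m}) * p ^ (m - 1)" by simp
    also have "\<dots> \<le> real (n ^ m * m ^ Suc (2 * k)) * p ^ (m - 1)"
      using p by (intro mult_right_mono of_nat_mono card_walks_card_le) auto
    also have "\<dots> = real n * real m ^ Suc (2 * k) * (real n * p) ^ (m - 1)"
      using m by (cases m) (auto simp: power_mult_distrib algebra_simps)
    \<comment> \<open>Because \<open>1 \<le> n * p\<close>, the largest admissible vertex count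
      \<open>k + 1\<close> dominates.\<close>
    also have "\<dots> \<le> real n * real (Suc k) ^ Suc (2 * k) * (real n * p) ^ k"
      using m np by (intro mult_mono mult_left_mono power_mono power_increasing) auto
    finally show "(\<Sum>xs\<in>{xs \<in> {xs \<in> ?W. card (set xs) \<in> {1..Suc k}}. card (set xs) = m}. p ^ (card (set xs) - 1))
        \<le> real n * real (Suc k) ^ Suc (2 * k) * (real n * p) ^ k" .
  qed
  \<comment> \<open>The number \<open>k + 1\<close> of groups supplies the last factor of the
    power.\<close>
  also have "\<dots> = real n * real (Suc k) ^ (2 * k + 2) * (real n * p) ^ k"
    by (simp add: algebra_simps)
  finally show ?thesis .
qed

section \<open>Second moments involving the flat vector\<close>

lemma graph_exp_centered_centered_le:
  assumes p: "0 \<le> p" "p \<le> 1" and ij: "i < n" "j < n" "k < n" "l < n"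
  shows "graph_exp n p (\<lambda>H. centered p H i j * centered p H k l) \<le> of_bool ({i, j} = {k, l}) * p"
proof -
  have "graph_exp n p (\<lambda>H. centered p H i j * centered p H k l) =
          graph_exp n p (\<lambda>H. \<Prod>e\<leftarrow>[{i, j}, {k, l}]. of_bool (e \<in> H) - p)"
    by (simp add: centered_def adj_def)
  also have "\<dots> \<le> of_bool ({i, j} = {k, l}) * p"
    using graph_exp_prod_list_centered[OF p, of "[{i, j}, {k, l}]" n] ij
    by (cases "{i, j} = {k, l}") (auto simp del: doubleton_eq_iff)
  finally show ?thesis .
qed

lemma graph_exp_nrm_centered_flat_le:
  assumes p: "0 \<le> p" "p \<le> 1" and n: "n \<ge> 1"
  shows "graph_exp n p (\<lambda>H. (nrm n (mat_app n (centered p H) (flat_vec n)))\<^sup>2) \<le> real n * p"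
proof -
  have "(nrm n (mat_app n (centered p H) (flat_vec n)))\<^sup>2 =
          (\<Sum>i<n. \<Sum>j<n. \<Sum>k<n. (1 / real n) * (centered p H i j * centered p H i k))" for H
  proof -
    have "mat_app n (centered p H) (flat_vec n) i * mat_app n (centered p H) (flat_vec n) i =
            (\<Sum>j<n. \<Sum>k<n. (1 / real n) * (centered p H i j * centered p H i k))" for i
      using n by (simp add: mat_app_def flat_vec_def sum_product)
    then show ?thesis by (simp add: nrm_power2 dot_def)
  qed
  then have "graph_exp n p (\<lambda>H. (nrm n (mat_app n (centered p H) (flat_vec n)))\<^sup>2) =
      (\<Sum>i<n. \<Sum>j<n. \<Sum>k<n. (1 / real n) * graph_exp n p (\<lambda>H. centered p H i j * centered p H i k))"
    by (simp only: graph_exp_sum graph_exp_cmult)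
  also have "\<dots> \<le> (\<Sum>i<n. \<Sum>j<n. \<Sum>k<n. (1 / real n) * (of_bool (k = j) * p))"
  proof (intro sum_mono mult_left_mono)
    fix i j k assume "i \<in> {..<n}" "j \<in> {..<n}" "k \<in> {..<n}"
    then have "graph_exp n p (\<lambda>H. centered p H i j * centered p H i k) \<le> of_bool ({i, j} = {i, k}) * p"
      by (intro graph_exp_centered_centered_le p) auto
    moreover have "{i, j} = {i, k} \<longleftrightarrow> k = j" by (auto simp: doubleton_eq_iff)
    ultimately show "graph_exp n p (\<lambda>H. centered p H i j * centered p H i k) \<le> of_bool (k = j) * p" by simp
  qed simp
  also have "\<dots> = (\<Sum>i<n. \<Sum>j<n. \<Sum>k<n. if k = j then p / real n else 0)"
    by (intro sum.cong refl) auto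
  also have "\<dots> = real n * p" using n by simp
  finally show ?thesis .
qed

text \<open>Only equal unordered pairs correlate. The pair \<open>{i, j}\<close> equals
  \<open>{k, l}\<close> for two orders of \<open>k\<close> and \<open>l\<close>, whence the factor
  2; counting loops twice only enlarges the bound.\<close>

lemma graph_exp_dot_centered_flat_le:
  assumes p: "0 \<le> p" "p \<le> 1" and n: "n \<ge> 1"
  shows "graph_exp n p (\<lambda>H. (dot n (flat_vec n) (mat_app n (centered p H) (flat_vec n)))\<^sup>2) \<le> 2 * p"
proof -
  have "(dot n (flat_vec n) (mat_app n (centered p H) (flat_vec n)))\<^sup>2 =
          (\<Sum>i<n. \<Sum>k<n. \<Sum>j<n. \<Sum>l<n. (1 / (real n)\<^sup>2) * (centered p H i j * centered p H k l))" for H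
  proof -
    have "dot n (flat_vec n) (mat_app n (centered p H) (flat_vec n)) = (\<Sum>i<n. \<Sum>j<n. centered p H i j) / real n"
      by (simp add: dot_def mat_app_def flat_vec_def flip: sum_divide_distrib real_sqrt_mult)
    then have "(dot n (flat_vec n) (mat_app n (centered p H) (flat_vec n)))\<^sup>2 =
                 (1 / (real n)\<^sup>2) * ((\<Sum>i<n. \<Sum>j<n. centered p H i j) * (\<Sum>k<n. \<Sum>l<n. centered p H k l))"
      by (simp add: power_divide power2_eq_square)
    then show ?thesis unfolding sum_product by (simp only: sum_distrib_left)
  qed
  then have "graph_exp n p (\<lambda>H. (dot n (flat_vec n) (mat_app n (centered p H) (flat_vec n)))\<^sup>2) =
      (\<Sum>i<n. \<Sum>k<n. \<Sum>j<n. \<Sum>l<n. (1 / (real n)\<^sup>2) * graph_exp n p (\<lambda>H. centered p H i j * centered p H k l))"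
    by (simp only: graph_exp_sum graph_exp_cmult)
  also have "\<dots> \<le> (\<Sum>i<n. \<Sum>k<n. \<Sum>j<n. \<Sum>l<n. (1 / (real n)\<^sup>2) *
      (of_bool (k = i) * of_bool (l = j) * p + of_bool (l = i) * of_bool (k = j) * p))"
  proof (intro sum_mono mult_left_mono)
    fix i j k l assume "i \<in> {..<n}" "j \<in> {..<n}" "k \<in> {..<n}" "l \<in> {..<n}"
    then have "graph_exp n p (\<lambda>H. centered p H i j * centered p H k l) \<le> of_bool ({i, j} = {k, l}) * p"
      by (intro graph_exp_centered_centered_le p) auto
    also have "\<dots> \<le> of_bool (k = i) * of_bool (l = j) * p + of_bool (l = i) * of_bool (k = j) * p"
      using p by (auto simp: doubleton_eq_iff)
    finally show "graph_exp n p (\<lambda>H. centered p H i j * centered p H k l) \<le>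
        of_bool (k = i) * of_bool (l = j) * p + of_bool (l = i) * of_bool (k = j) * p" .
  qed simp
  also have "\<dots> = (1 / (real n)\<^sup>2) * (\<Sum>i<n. \<Sum>k<n. \<Sum>j<n. \<Sum>l<n.
      (of_bool (k = i) * of_bool (l = j) * p + of_bool (l = i) * of_bool (k = j) * p))"
    by (simp only: sum_distrib_left)
  also have "(\<Sum>i<n. \<Sum>k<n. \<Sum>j<n. \<Sum>l<n.
      (of_bool (k = i) * of_bool (l = j) * p + of_bool (l = i) * of_bool (k = j) * p)) =
      (\<Sum>i<n. \<Sum>k<n. \<Sum>j<n. of_bool (k = i) * p + of_bool (k = j) * p)"
  proof (intro sum.cong refl)
    fix i j k assume "i \<in> {..<n}" "j \<in> {..<n}"
    moreover have "(\<Sum>l<n. of_bool (k = i) * of_bool (l = j) * p + of_bool (l = i) * of_bool (k = j) * p) =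
      (\<Sum>l<n. if l = j then of_bool (k = i) * p else 0) + (\<Sum>l<n. if l = i then of_bool (k = j) * p else 0)"
      unfolding sum.distrib[symmetric] by (intro sum.cong) auto
    ultimately show "(\<Sum>l<n. of_bool (k = i) * of_bool (l = j) * p + of_bool (l = i) * of_bool (k = j) * p) =
      of_bool (k = i) * p + of_bool (k = j) * p" by simp
  qed
  also have "\<dots> = (\<Sum>i<n. \<Sum>k<n. real n * (if k = i then p else 0) + p)"
  proof (intro sum.cong refl)
    fix i k assume "k \<in> {..<n}"
    moreover have "(\<Sum>j<n. of_bool (k = i) * p + of_bool (k = j) * p) =
      real n * (if k = i then p else 0) + (\<Sum>j<n. if j = k then p else 0)"
      unfolding sum.distrib by (auto intro!: sum.cong)
    ultimately show "(\<Sum>j<n. of_bool (k = i) * p + of_bool (k = j) * p) =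
      real n * (if k = i then p else 0) + p" by simp
  qed
  also have "\<dots> = 2 * (real n)\<^sup>2 * p"
    by (simp add: sum.distrib power2_eq_square flip: sum_distrib_left)
  finally show ?thesis using n by simp
qed

text \<open>Rewrites the Markov quotient for the trace so that the ratio
  \<open>x\<^sup>2 * K\<^sup>2 / d\<close>, whose high power has to beat \<open>n\<close>, becomes
  visible.\<close>

lemma power_ratio_eq:
  fixes c x d K :: real
  assumes "d > 0" "K > 0"
  shows "c * x ^ (2 * m + 2) * d ^ m / (d / K) ^ (2 * m) = c * x\<^sup>2 * (x\<^sup>2 * K\<^sup>2 / d) ^ m"
proof -
  have "c * (Y * y) * D / (D * D / Q) = c * y * (Y * Q / D)" if "D \<noteq> 0" "Q \<noteq> 0" for Y y D Q :: real
    using that by (simp add: field_simps)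
  from this[of "d ^ m" "(K\<^sup>2) ^ m" "(x\<^sup>2) ^ m" "x\<^sup>2"] assms show ?thesis
    by (simp add: power_add power_divide power_mult_distrib power_mult power2_eq_square)
qed

text \<open>Union bound over the clauses of \<open>regular\<close>, with Markov applied to the
  squared Frobenius norm of a power for the first and to the second moments for the others. The last
  two give \<open>1 / K + 2 * p / K\<close>, hence \<open>3 / K\<close>.\<close>

lemma graph_exp_not_regular_le:
  assumes p: "0 \<le> p" "p \<le> 1" and np: "1 \<le> real n * p" and K: "K > 0"
  shows "graph_exp n p (\<lambda>H. of_bool (\<not> regular n p K H)) \<le>
           real n * (real (Suc (Suc k)))\<^sup>2 * ((real (Suc (Suc k)))\<^sup>2 * K\<^sup>2 / (real n * p)) ^ Suc k
           + 3 / K"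
proof -
  define d where "d = real n * p"
  define s where "s = d / K"
  have d: "d \<ge> 1" using np by (simp add: d_def)
  have n: "n \<ge> 1" using np by (cases n) auto
  define F where "F H = (\<Sum>i<n. \<Sum>j<n. (mpow n (centered p H) (Suc k) i j)\<^sup>2)" for H
  define b2 where "b2 H = (nrm n (mat_app n (centered p H) (flat_vec n)))\<^sup>2" for H
  define q2 where "q2 H = (dot n (flat_vec n) (mat_app n (centered p H) (flat_vec n)))\<^sup>2" for H
  have s: "s > 0" using d K by (simp add: s_def)
  have le: "of_bool (\<not> regular n p K H) \<le> (of_bool (\<not> F H \<le> s ^ (2 * Suc k)) + of_bool (\<not> b2 H \<le> K * d)
          + of_bool (\<not> q2 H \<le> K) :: real)" for H
  proof (cases "F H \<le> s ^ (2 * Suc k)")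
    case True
    then have "nrm n (mat_app n (centered p H) x) \<le> d / K * nrm n x" for x
      using nrm_mat_app_le_of_mpow[where a = "centered p H" and s = s and k = k and n = n, OF centered_sym] s
      by (simp only: F_def s_def)
    then show ?thesis by (auto simp: regular_def b2_def q2_def d_def)
  qed auto
  have "graph_exp n p (\<lambda>H. of_bool (\<not> regular n p K H) :: real) \<le>
     graph_exp n p (\<lambda>H. of_bool (\<not> F H \<le> s ^ (2 * Suc k)) + of_bool (\<not> b2 H \<le> K * d) + of_bool (\<not> q2 H \<le> K))"
    by (rule graph_exp_mono[OF p]) (rule le)
  also have "\<dots> = graph_exp n p (\<lambda>H. of_bool (\<not> F H \<le> s ^ (2 * Suc k))) +
      graph_exp n p (\<lambda>H. of_bool (\<not> b2 H \<le> K * d)) + graph_exp n p (\<lambda>H. of_bool (\<not> q2 H \<le> K))"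
    by (simp only: graph_exp_add)
  also have "\<dots> \<le> real n * real (Suc (Suc k)) ^ (2 * Suc k + 2) * d ^ Suc k / s ^ (2 * Suc k)
      + d / (K * d) + 2 * p / K"
  proof (intro add_mono)
    have "graph_exp n p (\<lambda>H. of_bool (\<not> F H \<le> s ^ (2 * Suc k)) :: real) \<le> graph_exp n p F / s ^ (2 * Suc k)"
      using s by (intro graph_exp_markov p) (auto simp: F_def intro!: sum_nonneg)
    also have "\<dots> \<le> real n * real (Suc (Suc k)) ^ (2 * Suc k + 2) * d ^ Suc k / s ^ (2 * Suc k)"
      using graph_exp_frobenius_le[OF p np, of "Suc k"] s
      by (intro divide_right_mono) (simp_all only: F_def[abs_def] d_def zero_le_power less_imp_le)
    finally show "graph_exp n p (\<lambda>H. of_bool (\<not> F H \<le> s ^ (2 * Suc k))) \<le>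
        real n * real (Suc (Suc k)) ^ (2 * Suc k + 2) * d ^ Suc k / s ^ (2 * Suc k)" .
    have "graph_exp n p (\<lambda>H. of_bool (\<not> b2 H \<le> K * d) :: real) \<le> graph_exp n p b2 / (K * d)"
      using K d by (intro graph_exp_markov p) (auto simp: b2_def)
    also have "\<dots> \<le> d / (K * d)"
      using graph_exp_nrm_centered_flat_le[OF p n] K d by (intro divide_right_mono) (auto simp: b2_def[abs_def] d_def)
    finally show "graph_exp n p (\<lambda>H. of_bool (\<not> b2 H \<le> K * d)) \<le> d / (K * d)" .
    have "graph_exp n p (\<lambda>H. of_bool (\<not> q2 H \<le> K) :: real) \<le> graph_exp n p q2 / K"
      using K by (intro graph_exp_markov p) (auto simp: q2_def)
    also have "\<dots> \<le> 2 * p / K"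
      using graph_exp_dot_centered_flat_le[OF p n] K by (intro divide_right_mono) (auto simp: q2_def[abs_def])
    finally show "graph_exp n p (\<lambda>H. of_bool (\<not> q2 H \<le> K)) \<le> 2 * p / K" .
  qed
  also have "real n * real (Suc (Suc k)) ^ (2 * Suc k + 2) * d ^ Suc k / s ^ (2 * Suc k) =
      real n * (real (Suc (Suc k)))\<^sup>2 * ((real (Suc (Suc k)))\<^sup>2 * K\<^sup>2 / d) ^ Suc k"
    unfolding s_def using d K by (intro power_ratio_eq) auto
  finally have "graph_exp n p (\<lambda>H. of_bool (\<not> regular n p K H)) \<le>
      real n * (real (Suc (Suc k)))\<^sup>2 * ((real (Suc (Suc k)))\<^sup>2 * K\<^sup>2 / d) ^ Suc k
      + (d / (K * d) + 2 * p / K)" by (simp only: add.assoc)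
  moreover have "d / (K * d) + 2 * p / K \<le> 3 / K" using p d K by (simp add: field_simps)
  ultimately show ?thesis unfolding d_def by linarith
qed

section \<open>Exchangeability of the vertices\<close>

text \<open>Applied below to involutions: transpositions already carry any vertex to any other, and
  an involution is its own inverse, so one map serves for both directions of every
  reindexing.\<close>

definition relabel :: "(nat \<Rightarrow> nat) \<Rightarrow> nat set set \<Rightarrow> nat set set" where
  "relabel \<pi> H = (\<lambda>e. \<pi> ` e) ` H"

context
  fixes \<pi> :: "nat \<Rightarrow> nat" and n :: nat
  assumes invol: "\<And>x. \<pi> (\<pi> x) = x" and range': "\<forall>x<n. \<pi> x < n"
begin

private lemma range: "x < n \<Longrightarrow> \<pi> x < n"
  using range' by blast

private lemma sum_permute: "(\<Sum>i<n. f (\<pi> i)) = (\<Sum>i<n. f i)"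
  by (rule sum.reindex_bij_witness[of _ \<pi> \<pi>]) (auto simp: invol range)

private lemma image_invol: "\<pi> ` \<pi> ` e = e"
  by (simp add: image_image invol)

lemma relabel_relabel: "relabel \<pi> (relabel \<pi> H) = H"
  by (simp add: relabel_def image_image invol)

lemma relabel_subset: "H \<subseteq> vertex_pairs n \<Longrightarrow> relabel \<pi> H \<subseteq> vertex_pairs n"
proof
  fix e assume H: "H \<subseteq> vertex_pairs n" and "e \<in> relabel \<pi> H"
  then obtain e' where "e' \<in> vertex_pairs n" "e = \<pi> ` e'" by (auto simp: relabel_def)
  then obtain i j where "i < n" "j < n" "e = {\<pi> i, \<pi> j}" by (auto simp: vertex_pairs_def)
  then show "e \<in> vertex_pairs n" using range by simp
qed

lemma graph_weight_relabel: "graph_weight n p (relabel \<pi> H) = graph_weight n p H"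
proof -
  have "inj_on ((`) \<pi>) H" by (rule inj_on_inverseI[where g = "(`) \<pi>"]) (rule image_invol)
  then show ?thesis by (simp add: graph_weight_def relabel_def card_image)
qed

lemma graph_exp_relabel:
  fixes f :: "nat set set \<Rightarrow> real"
  shows "graph_exp n p (\<lambda>H. f (relabel \<pi> H)) = graph_exp n p f"
  unfolding graph_exp_def
proof (rule sum.reindex_bij_witness[where i = "relabel \<pi>" and j = "relabel \<pi>"])
  fix H assume "H \<in> Pow (vertex_pairs n)"
  then show "relabel \<pi> H \<in> Pow (vertex_pairs n)" using relabel_subset by blast
  then show "relabel \<pi> H \<in> Pow (vertex_pairs n)" .
qed (simp_all only: relabel_relabel graph_weight_relabel)

lemma adj_relabel: "adj (relabel \<pi> H) = (\<lambda>i j. adj H (\<pi> i) (\<pi> j))"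
proof (intro ext)
  fix i j
  have "{i, j} \<in> (`) \<pi> ` H \<longleftrightarrow> \<pi> ` {i, j} \<in> H"
  proof
    assume "{i, j} \<in> (`) \<pi> ` H"
    then obtain e where "e \<in> H" "{i, j} = \<pi> ` e" by blast
    then show "\<pi> ` {i, j} \<in> H" by (simp only: image_invol)
  next
    assume "\<pi> ` {i, j} \<in> H"
    then have "\<pi> ` \<pi> ` {i, j} \<in> (`) \<pi> ` H" by (rule imageI)
    then show "{i, j} \<in> (`) \<pi> ` H" by (simp only: image_invol)
  qed
  then show "adj (relabel \<pi> H) i j = adj H (\<pi> i) (\<pi> j)" by (simp add: adj_def relabel_def)
qed

lemma centered_relabel: "centered p (relabel \<pi> H) = (\<lambda>i j. centered p H (\<pi> i) (\<pi> j))"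
  by (intro ext) (simp add: centered_def adj_relabel)

private lemma mat_app_permute: "mat_app n (\<lambda>i j. a (\<pi> i) (\<pi> j)) x i = mat_app n a (\<lambda>i. x (\<pi> i)) (\<pi> i)"
  using sum_permute[of "\<lambda>j. a (\<pi> i) (\<pi> j) * x j"] by (simp add: mat_app_def invol)

private lemmas mat_app_relabel = mat_app_permute[where a = "centered p H" for p H, folded centered_relabel]
  mat_app_permute[where a = "adj H" for H, folded adj_relabel]

private lemma dot_permute: "dot n (\<lambda>i. x (\<pi> i)) (\<lambda>i. y (\<pi> i)) = dot n x y"
  unfolding dot_def by (rule sum_permute)

private lemma dot_permute': "dot n x (\<lambda>i. y (\<pi> i)) = dot n (\<lambda>i. x (\<pi> i)) y"
  using dot_permute[of "\<lambda>i. x (\<pi> i)" y] by (simp add: invol)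

private lemma nrm_permute: "nrm n (\<lambda>i. x (\<pi> i)) = nrm n x"
  by (simp add: nrm_eq_sqrt dot_permute)

private lemma mat_app_centered_flat: "mat_app n (centered p (relabel \<pi> H)) (flat_vec n) i = mat_app n (centered p H) (flat_vec n) (\<pi> i)"
  unfolding mat_app_relabel by (simp add: flat_vec_def[abs_def])

lemma regular_relabel:
  assumes "regular n p K H"
  shows "regular n p K (relabel \<pi> H)"
  unfolding regular_def
proof (intro conjI allI)
  fix x
  have "nrm n (mat_app n (centered p (relabel \<pi> H)) x) = nrm n (\<lambda>i. mat_app n (centered p H) (\<lambda>i. x (\<pi> i)) (\<pi> i))"
    by (rule nrm_cong) (rule mat_app_relabel)
  also have "\<dots> = nrm n (mat_app n (centered p H) (\<lambda>i. x (\<pi> i)))" by (rule nrm_permute)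
  also have "\<dots> \<le> real n * p / K * nrm n (\<lambda>i. x (\<pi> i))" using assms by (simp add: regular_def)
  finally show "nrm n (mat_app n (centered p (relabel \<pi> H)) x) \<le> real n * p / K * nrm n x"
    by (simp add: nrm_permute)
next
  show "(nrm n (mat_app n (centered p (relabel \<pi> H)) (flat_vec n)))\<^sup>2 \<le> K * (real n * p)"
    using assms by (simp add: regular_def mat_app_centered_flat[abs_def] nrm_permute)
next
  have "dot n (flat_vec n) (\<lambda>i. mat_app n (centered p H) (flat_vec n) (\<pi> i)) =
          dot n (flat_vec n) (mat_app n (centered p H) (flat_vec n))"
    unfolding dot_permute' by (rule dot_cong) (simp_all add: flat_vec_def)
  then show "(dot n (flat_vec n) (mat_app n (centered p (relabel \<pi> H)) (flat_vec n)))\<^sup>2 \<le> K"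
    using assms by (simp add: regular_def mat_app_centered_flat[abs_def])
qed

lemma top_pair_relabel:
  assumes "top_pair n (adj H) v l"
  shows "top_pair n (adj (relabel \<pi> H)) (\<lambda>i. v (\<pi> i)) l"
  unfolding top_pair_def
proof (intro conjI allI impI)
  fix i assume "i < n"
  then show "mat_app n (adj (relabel \<pi> H)) (\<lambda>i. v (\<pi> i)) i = l * v (\<pi> i)"
    using assms range by (simp add: mat_app_relabel top_pair_def invol)
next
  fix x
  have "dot n x (mat_app n (adj (relabel \<pi> H)) x) = dot n x (\<lambda>i. mat_app n (adj H) (\<lambda>i. x (\<pi> i)) (\<pi> i))"
    by (rule dot_cong[OF refl]) (rule mat_app_relabel)
  also have "\<dots> = dot n (\<lambda>i. x (\<pi> i)) (mat_app n (adj H) (\<lambda>i. x (\<pi> i)))" by (rule dot_permute')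
  also have "\<dots> \<le> l * dot n (\<lambda>i. x (\<pi> i)) (\<lambda>i. x (\<pi> i))" using assms by (simp add: top_pair_def)
  finally show "dot n x (mat_app n (adj (relabel \<pi> H)) x) \<le> l * dot n x x" by (simp add: dot_permute)
next
  show "dot n (\<lambda>i. v (\<pi> i)) (\<lambda>i. v (\<pi> i)) = 1" "0 \<le> (\<Sum>i<n. v (\<pi> i))"
    using assms by (simp_all add: top_pair_def dot_permute sum_permute)
qed

lemma remainder_relabel:
  "remainder n p (relabel \<pi> H) (\<lambda>i. v (\<pi> i)) i = remainder n p H v (\<pi> i)"
  by (simp add: remainder_def mat_app_centered_flat) (simp add: flat_vec_def)

end

text \<open>A selection depending on the graph alone, which makes the remainder a function that
  \<open>graph_exp\<close> can average and \<open>relabel\<close> can transport. The selection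
  itself need not respect relabelling; uniqueness ensures that it does on regular graphs.\<close>

definition top_vec :: "nat \<Rightarrow> nat set set \<Rightarrow> nat \<Rightarrow> real" where
  "top_vec n H = (SOME v. \<exists>l. top_pair n (adj H) v l)"

text \<open>The truncation restricts to graphs where the eigenvector is unique and
  \<open>remainder_le\<close> applies; elsewhere the value is zero.\<close>

definition typical_remainder2 :: "nat \<Rightarrow> real \<Rightarrow> real \<Rightarrow> nat set set \<Rightarrow> nat \<Rightarrow> real" where
  "typical_remainder2 n p K H i =
     of_bool (regular n p K H) * (remainder n p H (top_vec n H) i)\<^sup>2"

lemma top_pair_top_vec:
  assumes "n \<ge> 1"
  obtains l where "top_pair n (adj H) (top_vec n H) l"
proof -
  have "\<exists>v l. top_pair n (adj H) v l" by (rule exists_top_pair[where a = "adj H" and n = n, OF adj_sym assms]) blast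
  then have "\<exists>l. top_pair n (adj H) (top_vec n H) l" unfolding top_vec_def by (rule someI_ex)
  then show ?thesis using that by blast
qed

text \<open>By uniqueness of the top eigenvector the second moment of the remainder is the same at every vertex,
  so an \<open>\<ell>\<^sup>2\<close> bound on the whole vector controls a single coordinate.\<close>

lemma typical_remainder2_relabel:
  assumes n: "n \<ge> 1" and p: "p > 0" and K: "K \<ge> 8"
    and \<pi>: "\<And>x. \<pi> (\<pi> x) = x" "\<forall>x<n. \<pi> x < n" and i: "i < n"
  shows "typical_remainder2 n p K (relabel \<pi> H) i = typical_remainder2 n p K H (\<pi> i)"
proof -
  have reg: "regular n p K (relabel \<pi> H) \<longleftrightarrow> regular n p K H"
  proof
    assume "regular n p K (relabel \<pi> H)"
    then have "regular n p K (relabel \<pi> (relabel \<pi> H))" by (rule regular_relabel[where \<pi> = \<pi> and n = n, OF \<pi>])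
    then show "regular n p K H" by (simp only: relabel_relabel[where \<pi> = \<pi> and n = n, OF \<pi>])
  qed (rule regular_relabel[where \<pi> = \<pi> and n = n, OF \<pi>])
  show ?thesis
  proof (cases "regular n p K H")
    case True
    obtain l where l: "top_pair n (adj H) (top_vec n H) l" by (rule top_pair_top_vec[OF n])
    obtain l' where l': "top_pair n (adj (relabel \<pi> H)) (top_vec n (relabel \<pi> H)) l'"
      by (rule top_pair_top_vec[OF n])
    have "top_vec n (relabel \<pi> H) i = top_vec n H (\<pi> i)"
      using True reg by (intro top_pair_unique[OF n p K _ l' top_pair_relabel[where \<pi> = \<pi> and n = n, OF \<pi> l] i]) simp
    then have "remainder n p (relabel \<pi> H) (top_vec n (relabel \<pi> H)) i =
                 remainder n p (relabel \<pi> H) (\<lambda>i. top_vec n H (\<pi> i)) i"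
      by (simp add: remainder_def)
    then show ?thesis by (simp add: typical_remainder2_def reg remainder_relabel[where \<pi> = \<pi> and n = n, OF \<pi>])
  qed (simp add: typical_remainder2_def reg)
qed

lemma graph_exp_typical_remainder2_le:
  assumes n: "n \<ge> 1" and p: "0 < p" "p \<le> 1" and K: "K \<ge> 8" and i: "i < n"
  shows "(real n)\<^sup>2 * p * graph_exp n p (\<lambda>H. typical_remainder2 n p K H i) \<le>
           (10 * K / sqrt (real n * p) + 2 / sqrt K)\<^sup>2"
proof -
  let ?B = "(10 * K / sqrt (real n * p) + 2 / sqrt K)\<^sup>2"
  have same: "graph_exp n p (\<lambda>H. typical_remainder2 n p K H j) = graph_exp n p (\<lambda>H. typical_remainder2 n p K H i)"
    if j: "j < n" for j
  proof -
    let ?\<pi> = "Transposition.transpose i j"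
    have \<pi>: "\<And>x. ?\<pi> (?\<pi> x) = x" "\<forall>x<n. ?\<pi> x < n"
      using i j by (auto simp: Transposition.transpose_def)
    have "graph_exp n p (\<lambda>H. typical_remainder2 n p K H j) =
            graph_exp n p (\<lambda>H. typical_remainder2 n p K (relabel ?\<pi> H) i)"
      using typical_remainder2_relabel[OF n p(1) K, of ?\<pi>, OF \<pi> i] by simp
    also have "\<dots> = graph_exp n p (\<lambda>H. typical_remainder2 n p K H i)"
      using graph_exp_relabel[of ?\<pi> n, OF \<pi>, of p "\<lambda>H. typical_remainder2 n p K H i"] by simp
    finally show ?thesis .
  qed
  \<comment> \<open>One factor \<open>n\<close> is spent on replacing a single coordinate by the sum
    over all of them, leaving \<open>n * p * \<parallel>r\<parallel>\<^sup>2\<close>.\<close>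
  have "(real n)\<^sup>2 * p * graph_exp n p (\<lambda>H. typical_remainder2 n p K H i) =
          real n * p * (\<Sum>j<n. graph_exp n p (\<lambda>H. typical_remainder2 n p K H i))"
    by (simp add: power2_eq_square)
  also have "\<dots> = real n * p * (\<Sum>j<n. graph_exp n p (\<lambda>H. typical_remainder2 n p K H j))"
    using same by simp
  also have "\<dots> = graph_exp n p (\<lambda>H. real n * p * (\<Sum>j<n. typical_remainder2 n p K H j))"
    by (simp only: graph_exp_sum graph_exp_cmult)
  also have "\<dots> \<le> graph_exp n p (\<lambda>_. ?B)"
  proof (rule graph_exp_mono)
    fix H
    obtain l where l: "top_pair n (adj H) (top_vec n H) l" by (rule top_pair_top_vec[OF n])
    show "real n * p * (\<Sum>j<n. typical_remainder2 n p K H j) \<le> ?B"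
      using remainder_le[OF n p(1) K _ l] by (cases "regular n p K H") (auto simp: typical_remainder2_def)
  qed (use p in auto)
  finally show ?thesis by (simp add: graph_exp_const)
qed

section \<open>The characteristic function of a row sum\<close>

lemma norm_iexp_diff_le: "cmod (iexp a - iexp b) \<le> \<bar>a - b\<bar>"
proof -
  have "iexp a - iexp b = iexp b * (iexp (a - b) - 1)"
    by (simp add: algebra_simps flip: exp_add)
  then have "cmod (iexp a - iexp b) = cmod (iexp (a - b) - 1)"
    by (simp add: norm_mult)
  also have "\<dots> \<le> \<bar>a - b\<bar>" using iexp_approx1[of "a - b" 0] by simp
  finally show ?thesis .
qed

text \<open>The unordered pairs containing \<open>i\<close> correspond bijectively to the vertices
  \<open>j\<close>, the loop to \<open>j = i\<close>. A row therefore has exactly \<open>n\<close>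
  independent entries in spite of the symmetry of the matrix.\<close>

lemma graph_exp_iexp_row_sum:
  assumes i: "i < n"
  shows "graph_exp n p (\<lambda>H. iexp (s * (\<Sum>j<n. centered p H i j))) =
           (p *\<^sub>R iexp (s * (1 - p)) + (1 - p) *\<^sub>R iexp (- s * p)) ^ n"
proof -
  let ?V = "vertex_pairs n"
  define g where "g e b = (if i \<in> e then iexp (s * (of_bool b - p)) else 1)" for e b
  have bij: "bij_betw (\<lambda>j. {i, j}) {..<n} {e \<in> ?V. i \<in> e}"
    using i by (auto simp: bij_betw_def inj_on_def doubleton_eq_iff vertex_pairs_def)
  have "iexp (s * (\<Sum>j<n. centered p H i j)) = (\<Prod>e\<in>?V. g e (e \<in> H))" for H
  proof -
    have "iexp (s * (\<Sum>j<n. centered p H i j)) = (\<Prod>j<n. iexp (s * (of_bool ({i, j} \<in> H) - p)))"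
      by (simp add: centered_def adj_def sum_distrib_left exp_sum)
    also have "\<dots> = (\<Prod>e\<in>{e \<in> ?V. i \<in> e}. iexp (s * (of_bool (e \<in> H) - p)))"
      by (rule prod.reindex_bij_betw[OF bij])
    also have "\<dots> = (\<Prod>e\<in>?V. g e (e \<in> H))"
      unfolding g_def by (rule prod.inter_filter) simp
    finally show ?thesis .
  qed
  then have "graph_exp n p (\<lambda>H. iexp (s * (\<Sum>j<n. centered p H i j))) =
               (\<Prod>e\<in>?V. p *\<^sub>R g e True + (1 - p) *\<^sub>R g e False)"
    by (simp add: graph_exp_prod)
  also have "\<dots> = (\<Prod>e\<in>?V. if i \<in> e then p *\<^sub>R iexp (s * (1 - p)) + (1 - p) *\<^sub>R iexp (- s * p) else 1)"
    by (intro prod.cong refl) (simp add: g_def flip: scaleR_add_left)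
  also have "\<dots> = (\<Prod>e\<in>{e \<in> ?V. i \<in> e}. p *\<^sub>R iexp (s * (1 - p)) + (1 - p) *\<^sub>R iexp (- s * p))"
    by (rule prod.inter_filter[symmetric]) simp
  also have "\<dots> = (p *\<^sub>R iexp (s * (1 - p)) + (1 - p) *\<^sub>R iexp (- s * p)) ^ n"
    using bij_betw_same_card[OF bij] by simp
  finally show ?thesis .
qed

text \<open>Second-order Taylor expansion at both atoms: the linear terms cancel because the
  variable is centred, and the cubic errors add up to the third absolute moment.\<close>

lemma bernoulli_char_approx:
  fixes p s :: real
  assumes p: "0 \<le> p" "p \<le> 1"
  defines "\<phi> \<equiv> p *\<^sub>R iexp (s * (1 - p)) + (1 - p) *\<^sub>R iexp (- s * p)"
  shows "cmod \<phi> \<le> 1"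
    and "cmod (\<phi> - of_real (1 - p * (1 - p) * s\<^sup>2 / 2)) \<le> p * (1 - p) * \<bar>s\<bar> ^ 3 / 6"
proof -
  show "cmod \<phi> \<le> 1"
    unfolding \<phi>_def using p by (intro norm_triangle_le) simp
  define T where "T x = (\<Sum>k\<le>2. (\<i> * of_real x) ^ k / fact k)" for x
  have T: "cmod (iexp x - T x) \<le> \<bar>x\<bar> ^ 3 / 6" for x
    using iexp_approx1[of x 2] by (simp add: T_def fact_numeral eval_nat_numeral)
  have "p *\<^sub>R T (s * (1 - p)) + (1 - p) *\<^sub>R T (- s * p) = of_real (1 - p * (1 - p) * s\<^sup>2 / 2)"
    by (simp add: T_def eval_nat_numeral complex_eq_iff algebra_simps) (simp add: field_simps)
  then have "\<phi> - of_real (1 - p * (1 - p) * s\<^sup>2 / 2) =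
      p *\<^sub>R (iexp (s * (1 - p)) - T (s * (1 - p))) + (1 - p) *\<^sub>R (iexp (- s * p) - T (- s * p))"
    by (simp add: \<phi>_def scaleR_diff_right algebra_simps)
  also have "cmod \<dots> \<le> p * (\<bar>s * (1 - p)\<bar> ^ 3 / 6) + (1 - p) * (\<bar>- s * p\<bar> ^ 3 / 6)"
  proof (rule order_trans[OF norm_triangle_ineq add_mono])
    have "0 \<le> 1 - p" using p by simp
    then show "cmod ((1 - p) *\<^sub>R (iexp (- s * p) - T (- s * p))) \<le> (1 - p) * (\<bar>- s * p\<bar> ^ 3 / 6)"
      unfolding norm_scaleR by (simp only: abs_of_nonneg) (rule mult_left_mono[OF T])
    show "cmod (p *\<^sub>R (iexp (s * (1 - p)) - T (s * (1 - p)))) \<le> p * (\<bar>s * (1 - p)\<bar> ^ 3 / 6)"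
      unfolding norm_scaleR abs_of_nonneg[OF p(1)] by (rule mult_left_mono[OF T p(1)])
  qed
  also have "\<dots> = p * (1 - p) * \<bar>s\<bar> ^ 3 / 6 * ((1 - p)\<^sup>2 + p\<^sup>2)"
  proof -
    have "\<bar>s * (1 - p)\<bar> = \<bar>s\<bar> * (1 - p)" "\<bar>- s * p\<bar> = \<bar>s\<bar> * p"
      using p by (simp_all add: abs_mult)
    then show ?thesis
      by (simp only: power_mult_distrib) (simp add: power2_eq_square power3_eq_cube field_simps)
  qed
  also have "\<dots> \<le> p * (1 - p) * \<bar>s\<bar> ^ 3 / 6 * 1"
  proof (rule mult_left_mono)
    have "0 \<le> p * (1 - p)" using p by simp
    then show "(1 - p)\<^sup>2 + p\<^sup>2 \<le> 1" by (simp add: power2_eq_square algebra_simps)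
    show "0 \<le> p * (1 - p) * \<bar>s\<bar> ^ 3 / 6" using p by simp
  qed
  finally show "cmod (\<phi> - of_real (1 - p * (1 - p) * s\<^sup>2 / 2)) \<le> p * (1 - p) * \<bar>s\<bar> ^ 3 / 6" by simp
qed

text \<open>The characteristic function is an exact power, compared with
  \<open>(1 - t\<^sup>2 / (2 n)) ^ n\<close>. The \<open>n\<close> Taylor errors total
  \<open>\<bar>t\<bar> ^ 3 / 6\<close> divided by the standard deviation of the row sum. All rows
  have the same law, so the vertex may vary with \<open>n\<close>.\<close>

lemma graph_exp_iexp_row_sum_tendsto:
  fixes p :: "nat \<Rightarrow> real" and i :: "nat \<Rightarrow> nat"
  assumes p: "\<forall>\<^sub>F n in sequentially. 0 < p n \<and> p n \<le> 1 / 2"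
    and i: "\<forall>\<^sub>F n in sequentially. i n < n"
    and np: "filterlim (\<lambda>n. real n * p n) at_top sequentially"
  shows "(\<lambda>n. graph_exp n (p n) (\<lambda>H. iexp (t * ((\<Sum>j<n. centered (p n) H (i n) j) / sqrt (real n * p n * (1 - p n))))))
           \<longlonglongrightarrow> of_real (exp (- (t\<^sup>2) / 2))"
proof -
  define \<phi> where "\<phi> n = graph_exp n (p n) (\<lambda>H. iexp (t * ((\<Sum>j<n. centered (p n) H (i n) j) / sqrt (real n * p n * (1 - p n)))))" for n
  \<comment> \<open>This threshold places \<open>1 - t\<^sup>2 / (2 n)\<close> in
    \<open>[-1, 1]\<close>, as comparing powers of two numbers requires.\<close>
  have "\<forall>\<^sub>F n in sequentially. real n \<ge> t\<^sup>2 / 4"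
    using filterlim_real_sequentially unfolding filterlim_at_top by (rule spec)
  moreover have "\<forall>\<^sub>F n in sequentially. n \<ge> 1" by (rule eventually_ge_at_top)
  ultimately have main: "\<forall>\<^sub>F n in sequentially.
      cmod (\<phi> n - of_real ((1 + (- (t\<^sup>2) / 2) / n) ^ n)) \<le> \<bar>t\<bar> ^ 3 / 6 * (1 / sqrt (real n * p n * (1 / 2)))"
    using p i
  proof eventually_elim
    case (elim n)
    define q where "q = p n"
    define D where "D = real n * q * (1 - q)"
    define s where "s = t / sqrt D"
    have q: "0 < q" "q \<le> 1/2" using elim by (auto simp: q_def)
    have D: "D > 0" using q elim by (simp add: D_def)
    define \<psi> where "\<psi> = q *\<^sub>R iexp (s * (1 - q)) + (1 - q) *\<^sub>R iexp (- s * q)"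
    have eq: "\<phi> n = \<psi> ^ n"
      unfolding \<psi>_def using graph_exp_iexp_row_sum[of "i n" n q s] elim
      by (simp add: \<phi>_def q_def D_def s_def)
    have s2: "q * (1 - q) * s\<^sup>2 = t\<^sup>2 / n"
      using D q elim by (simp add: s_def power_divide) (simp add: D_def field_simps)
    have "1 - q * (1 - q) * s\<^sup>2 / 2 = 1 + (- (t\<^sup>2) / 2) / n" unfolding s2 by simp
    note approx = bernoulli_char_approx[of q s, folded \<psi>_def, unfolded this]
    have "cmod (\<phi> n - of_real ((1 + (- (t\<^sup>2) / 2) / n) ^ n)) =
            cmod (\<psi> ^ n - (of_real (1 + (- (t\<^sup>2) / 2) / n)) ^ n)" by (simp add: eq)
    also have "\<dots> \<le> n * cmod (\<psi> - of_real (1 + (- (t\<^sup>2) / 2) / n))"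
    proof (rule norm_power_diff)
      show "cmod \<psi> \<le> 1" using approx(1) q by simp
      have "\<bar>1 + (- (t\<^sup>2) / 2) / n\<bar> \<le> 1" using elim by (auto simp: abs_le_iff field_simps)
      then show "cmod (of_real (1 + (- (t\<^sup>2) / 2) / n)) \<le> 1" by (simp only: norm_of_real)
    qed
    also have "\<dots> \<le> n * (q * (1 - q) * \<bar>s\<bar> ^ 3 / 6)"
      using approx(2) q by (intro mult_left_mono) auto
    also have "\<dots> = n * (q * (1 - q) * s\<^sup>2) * \<bar>s\<bar> / 6"
      by (simp add: power2_eq_square power3_eq_cube abs_mult[symmetric] flip: mult.assoc)
    also have "\<dots> = \<bar>t\<bar> ^ 3 / 6 * (1 / sqrt D)"
      unfolding s2 using elim D
      by (simp add: s_def power3_eq_cube power2_eq_square abs_mult)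
    also have "\<dots> \<le> \<bar>t\<bar> ^ 3 / 6 * (1 / sqrt (real n * q * (1 / 2)))"
      using q elim unfolding D_def
      by (intro mult_left_mono divide_left_mono real_sqrt_le_mono) auto
    finally show ?case by (simp add: q_def)
  qed
  have "filterlim (\<lambda>n. sqrt (real n * p n * (1 / 2))) at_top sequentially"
    by (intro filterlim_compose[OF sqrt_at_top] filterlim_at_top_mult_tendsto_pos[OF tendsto_const _ np]) simp
  then have "(\<lambda>n. \<bar>t\<bar> ^ 3 / 6 * (1 / sqrt (real n * p n * (1 / 2)))) \<longlonglongrightarrow> 0"
    by (intro tendsto_mult_right_zero tendsto_divide_0[OF tendsto_const] filterlim_at_top_imp_at_infinity)
  then have diff: "(\<lambda>n. \<phi> n - of_real ((1 + (- (t\<^sup>2) / 2) / n) ^ n)) \<longlonglongrightarrow> 0"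
    by (rule Lim_null_comparison[OF main])
  have "(\<lambda>n. complex_of_real ((1 + (- (t\<^sup>2) / 2) / n) ^ n)) \<longlonglongrightarrow> of_real (exp (- (t\<^sup>2) / 2))"
    by (rule isCont_tendsto_compose[OF _ tendsto_exp_limit_sequentially]) auto
  then show ?thesis unfolding \<phi>_def[symmetric] by (rule Lim_transform[OF _ diff])
qed

section \<open>Convergence of the eigenvector coordinate\<close>

text \<open>With \<open>K = L = ln n\<close> and \<open>k\<close> the ceiling of \<open>L\<close>,
  the ratio to be raised to the power \<open>k + 1\<close> is at most \<open>4 / L ^ 4\<close>,
  which is below \<open>exp (- 3)\<close> for \<open>L \<ge> 8\<close>. Its power is then at most
  \<open>n\<close> to the minus 3, enough to absorb the prefactor
  \<open>n * x\<^sup>2\<close>.\<close>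

lemma graph_exp_not_regular_ln_le:
  assumes p: "0 \<le> p" "p \<le> 1" and L: "ln (real n) \<ge> 8" and np: "ln (real n) ^ 8 \<le> real n * p"
  shows "graph_exp n p (\<lambda>H. of_bool (\<not> regular n p (ln (real n)) H)) \<le>
           real n * (4 * (ln (real n))\<^sup>2) * exp (- 3 * ln (real n)) + 3 / ln (real n)"
proof -
  define L where "L = ln (real n)"
  define k where "k = nat \<lceil>L\<rceil>"
  define x where "x = real (Suc (Suc k))"
  have L8: "L \<ge> 8" using assms by (simp add: L_def)
  have k: "L \<le> real k" "real k \<le> L + 1" using L8 unfolding k_def by linarith+
  \<comment> \<open>\<open>x = k + 2 \<le> L + 3\<close>, and \<open>L \<ge> 8\<close>.\<close>
  have x: "0 \<le> x" "x \<le> 2 * L" using k L8 by (simp_all add: x_def)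
  have d: "L ^ 8 \<le> real n * p" using np by (simp add: L_def)
  have "1 \<le> L ^ 8" using L8 by (intro one_le_power) simp
  then have d1: "1 \<le> real n * p" using d by linarith
  have "x\<^sup>2 * L\<^sup>2 / (real n * p) \<le> (2 * L)\<^sup>2 * L\<^sup>2 / L ^ 8"
    using x L8 d d1 by (intro frac_le mult_mono power_mono) auto
  also have "\<dots> = 4 / L ^ 4"
    using L8 by (simp add: power_mult_distrib field_simps flip: power_add)
  also have "\<dots> \<le> 4 / 8 ^ 4"
    using L8 by (intro divide_left_mono power_mono) auto
  also have "\<dots> \<le> exp (- 3)"
  proof -
    have "exp (3 :: real) = exp 1 ^ 3" by (simp flip: exp_of_nat_mult)
    also have "\<dots> \<le> 3 ^ 3" by (intro power_mono exp_le) auto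
    finally show ?thesis by (simp add: exp_minus field_simps)
  qed
  finally have "(x\<^sup>2 * L\<^sup>2 / (real n * p)) ^ Suc k \<le> exp (- 3) ^ Suc k"
    using x L8 d1 by (intro power_mono) auto
  also have "\<dots> = exp (- 3 * real (Suc k))" by (simp only: exp_of_nat2_mult)
  also have "\<dots> \<le> exp (- 3 * L)" using k by simp
  finally have pow: "(x\<^sup>2 * L\<^sup>2 / (real n * p)) ^ Suc k \<le> exp (- 3 * L)" .
  have "graph_exp n p (\<lambda>H. of_bool (\<not> regular n p L H)) \<le>
          real n * x\<^sup>2 * (x\<^sup>2 * L\<^sup>2 / (real n * p)) ^ Suc k + 3 / L"
    unfolding x_def by (rule graph_exp_not_regular_le[OF p d1]) (use L8 in simp)
  also have "real n * x\<^sup>2 * (x\<^sup>2 * L\<^sup>2 / (real n * p)) ^ Suc k \<le> real n * (2 * L)\<^sup>2 * exp (- 3 * L)"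
    using x d1 by (intro mult_mono pow power_mono mult_left_mono) auto
  finally show ?thesis by (simp add: L_def power_mult_distrib)
qed

text \<open>On regular graphs the exponentials differ by at most \<open>\<bar>t\<bar>\<close> times
  the rescaled remainder; on the others the trivial bound 2 is used.\<close>

lemma (in erdos_renyi_graph) char_top_eigenvector_coordinate_le:
  fixes V :: "'w \<Rightarrow> nat \<Rightarrow> real" and t K :: real
  defines "B \<equiv> 10 * K / sqrt (real n * p) + 2 / sqrt K"
  assumes n: "n \<ge> 1" and p: "0 < p" "p \<le> 1 / 2" and K: "K \<ge> 8" and i: "i < n"
    and V: "\<And>\<omega>. \<omega> \<in> space M \<Longrightarrow> \<exists>l. top_pair n (adj (G \<omega>)) (V \<omega>) l"
    and meas [measurable]: "(\<lambda>\<omega>. V \<omega> i) \<in> borel_measurable M"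
  shows "cmod (expectation (\<lambda>\<omega>. iexp (t * (real n * sqrt (p / (1 - p)) * (V \<omega> i - 1 / sqrt (real n))))) -
            graph_exp n p (\<lambda>H. iexp (t * ((\<Sum>j<n. centered p H i j) / sqrt (real n * p * (1 - p)))))) \<le>
           2 * graph_exp n p (\<lambda>H. of_bool (\<not> regular n p K H)) + 2 * \<bar>t\<bar> * B"
proof -
  define c where "c = real n * sqrt (p / (1 - p))"
  define X where "X H = (\<Sum>j<n. centered p H i j) / sqrt (real n * p * (1 - p))" for H
  define Y where "Y \<omega> = c * (V \<omega> i - 1 / sqrt (real n))" for \<omega>
  \<comment> \<open>The quadratic term comes from
    \<open>a \<le> a\<^sup>2 / (2 * B) + B / 2\<close>. It trades the absolute value of the
    remainder for its second moment without a Cauchy-Schwarz inequality for expectations;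
    \<open>B\<close> is the expected size of \<open>a\<close>.\<close>
  define h where "h H = 2 * of_bool (\<not> regular n p K H) +
      \<bar>t\<bar> * (c\<^sup>2 / (2 * B) * typical_remainder2 n p K H i + B / 2)" for H
  have np: "real n * p > 0" using n p by simp
  have B: "B > 0" using np K unfolding B_def by (intro add_nonneg_pos) auto
  have [measurable]: "Y \<in> borel_measurable M" unfolding Y_def by measurable
  \<comment> \<open>The normalisation of the theorem turns the first-order term of the expansion
    into the standardised row sum exactly, so only the remainder is left.\<close>
  have diff: "Y \<omega> - X H = c * remainder n p H (V \<omega>) i" for \<omega> H
  proof -
    have row: "mat_app n (centered p H) (flat_vec n) i = (\<Sum>j<n. centered p H i j) / sqrt (real n)"
      by (simp add: mat_app_def flat_vec_def sum_divide_distrib)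
    have "c / sqrt (real n) / (real n * p) = 1 / sqrt (real n * p * (1 - p))"
    proof -
      have "sqrt p / p = 1 / sqrt p" using p by (simp add: sqrt_divide_self_eq inverse_eq_divide)
      moreover have "c / sqrt (real n) / (real n * p) = sqrt p / p / (sqrt (real n) * sqrt (1 - p))"
        using n by (simp add: c_def real_sqrt_divide)
      ultimately show ?thesis by (simp add: real_sqrt_mult)
    qed
    moreover have "X H = (\<Sum>j<n. centered p H i j) * (1 / sqrt (real n * p * (1 - p)))" by (simp add: X_def)
    ultimately have "X H = (\<Sum>j<n. centered p H i j) * (c / sqrt (real n) / (real n * p))" by (simp only:)
    also have "\<dots> = c * (mat_app n (centered p H) (flat_vec n) i / (real n * p))" by (simp add: row)
    finally show ?thesis by (simp add: Y_def remainder_def flat_vec_def algebra_simps)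
  qed
  have bound: "cmod (iexp (t * Y \<omega>) - iexp (t * X (G \<omega>))) \<le> h (G \<omega>)" if \<omega>: "\<omega> \<in> space M" for \<omega>
  proof (cases "regular n p K (G \<omega>)")
    case True
    obtain l where l: "top_pair n (adj (G \<omega>)) (V \<omega>) l" using V[OF \<omega>] by blast
    obtain l' where l': "top_pair n (adj (G \<omega>)) (top_vec n (G \<omega>)) l'" by (rule top_pair_top_vec[OF n])
    have "V \<omega> i = top_vec n (G \<omega>) i" by (rule top_pair_unique[OF n p(1) K True l l' i])
    then have r: "remainder n p (G \<omega>) (V \<omega>) i = remainder n p (G \<omega>) (top_vec n (G \<omega>)) i"
      by (simp add: remainder_def)
    define a where "a = \<bar>c * remainder n p (G \<omega>) (V \<omega>) i\<bar>"
    have "0 \<le> (a - B)\<^sup>2" by simp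
    then have "2 * a * B \<le> a\<^sup>2 + B\<^sup>2" by (simp add: power2_eq_square algebra_simps)
    then have aB: "a \<le> a\<^sup>2 / (2 * B) + B / 2" using B by (simp add: field_simps power2_eq_square)
    have "cmod (iexp (t * Y \<omega>) - iexp (t * X (G \<omega>))) \<le> \<bar>t * Y \<omega> - t * X (G \<omega>)\<bar>"
      by (rule norm_iexp_diff_le)
    also have "\<dots> = \<bar>t\<bar> * \<bar>Y \<omega> - X (G \<omega>)\<bar>" by (simp only: right_diff_distrib[symmetric] abs_mult)
    also have "\<dots> = \<bar>t\<bar> * a" by (simp only: diff a_def)
    also have "\<dots> \<le> \<bar>t\<bar> * (a\<^sup>2 / (2 * B) + B / 2)" by (rule mult_left_mono[OF aB]) simp
    also have "\<dots> = h (G \<omega>)"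
      using True by (simp add: h_def typical_remainder2_def a_def r power_mult_distrib)
    finally show ?thesis .
  next
    case False
    have "cmod (iexp (t * Y \<omega>) - iexp (t * X (G \<omega>))) \<le> 2"
      by (rule order_trans[OF norm_triangle_ineq4]) (simp del: of_real_mult)
    also have "\<dots> \<le> h (G \<omega>)" using False B by (simp add: h_def typical_remainder2_def)
    finally show ?thesis .
  qed
  have intY: "integrable M (\<lambda>\<omega>. iexp (t * Y \<omega>))"
    by (rule integrable_const_bound[where B = 1]) auto
  have intX: "integrable M (\<lambda>\<omega>. iexp (t * X (G \<omega>)))"
    by (rule integrable_graph[OF n])
  have "expectation (\<lambda>\<omega>. iexp (t * Y \<omega>)) - graph_exp n p (\<lambda>H. iexp (t * X H)) =
          expectation (\<lambda>\<omega>. iexp (t * Y \<omega>) - iexp (t * X (G \<omega>)))"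
    using Bochner_Integration.integral_diff[OF intY intX] expectation_graph[OF n, of "\<lambda>H. iexp (t * X H)"]
    by simp
  also have "cmod \<dots> \<le> expectation (\<lambda>\<omega>. h (G \<omega>))"
  proof (rule order_trans[OF integral_norm_bound integral_mono])
    show "integrable M (\<lambda>\<omega>. cmod (iexp (t * Y \<omega>) - iexp (t * X (G \<omega>))))"
      by (intro integrable_norm Bochner_Integration.integrable_diff intY intX)
    show "integrable M (\<lambda>\<omega>. h (G \<omega>))" by (rule integrable_graph[OF n])
  qed (rule bound)
  also have "\<dots> = graph_exp n p h" by (rule expectation_graph[OF n])
  also have "\<dots> = 2 * graph_exp n p (\<lambda>H. of_bool (\<not> regular n p K H)) +
      \<bar>t\<bar> * (c\<^sup>2 / (2 * B) * graph_exp n p (\<lambda>H. typical_remainder2 n p K H i) + B / 2)"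
    unfolding h_def by (simp only: graph_exp_add graph_exp_cmult graph_exp_const)
  \<comment> \<open>As \<open>p \<le> 1 / 2\<close>, \<open>c\<^sup>2\<close> is at most
    \<open>2 * n\<^sup>2 * p\<close>. The second-moment bound then gives \<open>B + B / 2\<close>,
    which is rounded up to \<open>2 * B\<close>.\<close>
  also have "c\<^sup>2 / (2 * B) * graph_exp n p (\<lambda>H. typical_remainder2 n p K H i) + B / 2 \<le> 2 * B"
  proof -
    let ?E = "graph_exp n p (\<lambda>H. typical_remainder2 n p K H i)"
    have "graph_exp n p (\<lambda>_. 0) \<le> ?E"
      using p by (intro graph_exp_mono) (auto simp: typical_remainder2_def)
    then have E: "0 \<le> ?E" by (simp add: graph_exp_const)
    have "c\<^sup>2 = (real n)\<^sup>2 * (p / (1 - p))" using p by (simp add: c_def power_mult_distrib)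
    also have "\<dots> \<le> (real n)\<^sup>2 * (2 * p)"
      using p by (intro mult_left_mono) (simp_all add: divide_le_eq algebra_simps)
    finally have "c\<^sup>2 * ?E \<le> (real n)\<^sup>2 * (2 * p) * ?E" using E by (rule mult_right_mono)
    moreover have "(real n)\<^sup>2 * p * ?E \<le> B\<^sup>2"
      unfolding B_def by (rule graph_exp_typical_remainder2_le[OF n p(1) _ K i]) (use p in simp)
    ultimately have "c\<^sup>2 * ?E \<le> 2 * B\<^sup>2" by simp
    then have "c\<^sup>2 * ?E / (2 * B) \<le> 2 * B\<^sup>2 / (2 * B)" using B by (intro divide_right_mono) auto
    then show ?thesis using B by (simp add: power2_eq_square)
  qed
  finally show ?thesis
    unfolding X_def Y_def c_def by (simp add: mult_left_mono mult.assoc)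
qed

theorem corollary1p7:
  fixes M :: "nat \<Rightarrow> 'w measure"
    and G :: "nat \<Rightarrow> 'w \<Rightarrow> nat set set"
    and v\<^sub>1 :: "nat \<Rightarrow> 'w \<Rightarrow> real Matrix.vec"
    and p :: "nat \<Rightarrow> real"
    and \<xi> :: real
    and i :: "nat \<Rightarrow> nat"
  assumes graph: "\<And>n. n \<ge> 1 \<Longrightarrow> erdos_renyi_graph (M n) n (p n) (G n)"
    and xi: "\<xi> > 2"
    and p_lower: "(\<lambda>n. ln (real n) powr (4 * \<xi>) / real n) \<in> o(p)"
    and p_upper: "p \<in> o(\<lambda>n. real n powr (- 1 / 2))"
    and eigenvector: "\<And>n \<omega>. n \<ge> 1 \<Longrightarrow> \<omega> \<in> space (M n) \<Longrightarrow>
          normalized_top_eigenvector (adjacency_matrix n (G n \<omega>)) (v\<^sub>1 n \<omega>)"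
    and measurable: "\<And>n j. n \<ge> 1 \<Longrightarrow> j < n \<Longrightarrow>
          (\<lambda>\<omega>. vec_index (v\<^sub>1 n \<omega>) j) \<in> borel_measurable (M n)"
    and vertex: "\<And>n. n \<ge> 1 \<Longrightarrow> i n < n"
  shows "weak_conv_m
           (\<lambda>n. distr (M n) borel (\<lambda>\<omega>. real n * sqrt (p n / (1 - p n)) *
                  (vec_index (v\<^sub>1 n \<omega>) (i n) - 1 / sqrt (real n))))
           std_normal_distribution"
proof -
  define Y where "Y n \<omega> = real n * sqrt (p n / (1 - p n)) *
                  (vec_index (v\<^sub>1 n \<omega>) (i n) - 1 / sqrt (real n))" for n \<omega>
  define \<mu> where "\<mu> n = distr (M n) borel (Y n)" for n
  have Y_meas: "Y n \<in> borel_measurable (M n)" if "n \<ge> 1" for n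
  proof -
    have [measurable]: "(\<lambda>\<omega>. vec_index (v\<^sub>1 n \<omega>) (i n)) \<in> borel_measurable (M n)"
      by (rule measurable[OF that vertex[OF that]])
    show ?thesis unfolding Y_def by measurable
  qed
  have p01: "0 \<le> p n" "p n \<le> 1" if "n \<ge> 1" for n
    using erdos_renyi_graph.p_bounds[OF graph[OF that] that] by auto
  have ge1: "\<forall>\<^sub>F n in sequentially. n \<ge> (1 :: nat)" by (rule eventually_ge_at_top)
  have ln_ge: "\<forall>\<^sub>F n in sequentially. ln (real n) \<ge> 8" by real_asymp
  \<comment> \<open>The exponent 8 is \<open>4 * 2\<close>: from \<open>\<xi> > 2\<close> and
    \<open>ln n \<ge> 1\<close> the lower bound on \<open>p\<close> majorises
    \<open>(ln n) ^ 8 / n\<close>.\<close>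
  have np_ge: "\<forall>\<^sub>F n in sequentially. ln (real n) ^ 8 \<le> real n * p n"
    using landau_o.smallD[OF p_lower, of 1, simplified] ln_ge ge1
  proof eventually_elim
    case (elim n)
    have "ln (real n) ^ 8 = ln (real n) powr 8" using elim by (simp add: powr_numeral)
    also have "\<dots> \<le> ln (real n) powr (4 * \<xi>)" using elim xi by (intro powr_mono) auto
    also have "\<dots> \<le> real n * p n" using elim p01[of n] by (simp add: divide_le_eq mult.commute)
    finally show ?case .
  qed
  \<comment> \<open>Eventually \<open>p n\<close> is at most half of
    \<open>n powr (- 1 / 2)\<close>, hence at most 1/2; positivity follows from the lower bound on
    \<open>n * p n\<close>.\<close>
  have p_small: "\<forall>\<^sub>F n in sequentially. 0 < p n \<and> p n \<le> 1 / 2"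
    using landau_o.smallD[OF p_upper, of "1/2", simplified] np_ge ln_ge ge1
  proof eventually_elim
    case (elim n)
    have "0 < ln (real n) ^ 8" using elim by (intro zero_less_power) linarith
    then have "0 < real n * p n" using elim by linarith
    then have "0 < p n" by (simp add: zero_less_mult_iff)
    moreover have "\<bar>p n\<bar> * 2 \<le> real n powr - (1 / 2)" using elim(1) by simp
    moreover have "real n powr - (1 / 2) \<le> real n powr 0" using elim by (intro powr_mono) auto
    moreover have "real n powr 0 = 1" using elim by simp
    ultimately show ?case by linarith
  qed
  have i_less: "\<forall>\<^sub>F n in sequentially. i n < n" using ge1 vertex by (rule eventually_mono)
  have ln8: "filterlim (\<lambda>n. ln (real n) ^ 8) at_top sequentially" by real_asymp
  have np_top: "filterlim (\<lambda>n. real n * p n) at_top sequentially"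
    by (rule filterlim_at_top_mono[OF ln8 np_ge])
  define \<gamma> where "\<gamma> t n = graph_exp n (p n) (\<lambda>H. iexp (t * ((\<Sum>j<n. centered (p n) H (i n) j) /
      sqrt (real n * p n * (1 - p n)))))" for t n
  have "(\<lambda>n. char (\<mu> n) t) \<longlonglongrightarrow> char std_normal_distribution t" for t
  proof -
    \<comment> \<open>The choice \<open>K = ln n\<close>, with \<open>n * p\<close> replaced by its
      lower bound \<open>(ln n) ^ 8\<close>. Every term then depends on \<open>n\<close> alone; the
      slowest ones decay like \<open>1 / sqrt (ln n)\<close>.\<close>
    define R where "R n = 2 * (real n * (4 * (ln (real n))\<^sup>2) * exp (- 3 * ln (real n)) + 3 / ln (real n)) +
        2 * \<bar>t\<bar> * (10 * ln (real n) / sqrt (ln (real n) ^ 8) + 2 / sqrt (ln (real n)))" for n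
    have "\<forall>\<^sub>F n in sequentially. cmod (char (\<mu> n) t - \<gamma> t n) \<le> R n"
      using ge1 ln_ge np_ge p_small
    proof eventually_elim
      case (elim n)
      interpret erdos_renyi_graph "M n" n "p n" "G n" by (rule graph) fact
      have n: "n \<ge> 1" and L: "ln (real n) \<ge> 8" and p: "0 < p n" "p n \<le> 1 / 2" using elim by auto
      have V: "\<exists>l. top_pair n (adj (G n \<omega>)) (vec_index (v\<^sub>1 n \<omega>)) l" if "\<omega> \<in> space (M n)" for \<omega>
        by (rule normalized_top_eigenvector_top_pair[OF eigenvector[OF n that] n]) blast
      have char: "char (\<mu> n) t = expectation (\<lambda>\<omega>. iexp (t * Y n \<omega>))"
        unfolding \<mu>_def char_def by (rule integral_distr) (auto intro: Y_meas[OF n])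
      have "cmod (char (\<mu> n) t - \<gamma> t n) \<le>
          2 * graph_exp n (p n) (\<lambda>H. of_bool (\<not> regular n (p n) (ln (real n)) H)) +
          2 * \<bar>t\<bar> * (10 * ln (real n) / sqrt (real n * p n) + 2 / sqrt (ln (real n)))"
        unfolding char \<gamma>_def Y_def
        by (rule char_top_eigenvector_coordinate_le[OF n p L vertex[OF n] V measurable[OF n vertex[OF n]]])
      also have "\<dots> \<le> R n"
        unfolding R_def
      proof (intro add_mono mult_left_mono divide_left_mono)
        show "graph_exp n (p n) (\<lambda>H. of_bool (\<not> regular n (p n) (ln (real n)) H)) \<le>
            real n * (4 * (ln (real n))\<^sup>2) * exp (- 3 * ln (real n)) + 3 / ln (real n)"
          by (rule graph_exp_not_regular_ln_le[OF _ _ L elim(3)]) (use p in auto)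
        show "sqrt (ln (real n) ^ 8) \<le> sqrt (real n * p n)" using elim(3) by simp
        show "0 < sqrt (real n * p n) * sqrt (ln (real n) ^ 8)" 
          by (intro mult_pos_pos real_sqrt_gt_zero zero_less_power) (use L n p in linarith | simp add: n p)+
      qed (use L in auto)
      finally show ?case .
    qed
    moreover have "R \<longlonglongrightarrow> 0" unfolding R_def by real_asymp
    ultimately have diff: "(\<lambda>n. char (\<mu> n) t - \<gamma> t n) \<longlonglongrightarrow> 0" by (rule Lim_null_comparison)
    have "\<gamma> t \<longlonglongrightarrow> char std_normal_distribution t"
      unfolding \<gamma>_def char_std_normal_distribution
      by (rule graph_exp_iexp_row_sum_tendsto[OF p_small i_less np_top])
    then show ?thesis by (rule Lim_transform[OF _ diff])
  qed
  \<comment> \<open>\<open>M 0\<close> need not be a probability space, so the continuity theorem is applied from index 1 on\<close>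
  then have "(\<lambda>n. char (\<mu> (Suc n)) t) \<longlonglongrightarrow> char std_normal_distribution t" for t
    by (rule LIMSEQ_Suc)
  moreover have "real_distribution (\<mu> (Suc n))" for n
  proof -
    interpret erdos_renyi_graph "M (Suc n)" "Suc n" "p (Suc n)" "G (Suc n)" by (rule graph) simp
    show ?thesis unfolding \<mu>_def by (rule real_distribution_distr) (simp add: Y_meas)
  qed
  ultimately have "weak_conv_m (\<lambda>n. \<mu> (Suc n)) std_normal_distribution"
    by (intro levy_continuity real_dist_normal_dist)
  then have "weak_conv_m \<mu> std_normal_distribution"
    unfolding weak_conv_m_def weak_conv_def 
    by (simp add: filterlim_sequentially_Suc[of "\<lambda>n. cdf (\<mu> n) _"])
  then show ?thesis unfolding \<mu>_def Y_def .
qed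

end
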